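(* If $(X_n)_{n\ge1}$ is a boundedly complete SBD for a Banach space $X$, then $(X_n)$ is a $K_\infty$-norming-JT-decomposition for $X$, where $K_\infty$ is the asymptotic SBD-constant of $(X_n)$.
   Context: $[\,\cdot\,]$ denotes closed linear span. For a sequence $(X_n)$ of finite dimensional subspaces of a Banach space $X$, $X[m,k]=[X_n]_{n=m}^k$ and $X[m,\infty)=[X_n]_{n\ge m}$, with $X[1,0]=\{0\}$. SBD (skipped-blocking decomposition): $(X_n)$ is an SBD for $X$ if (1) $X=[X_n]_{n\ge1}$; (2) $X_n\cap[X_m]_{m\ne n}=\{0\}$ for each $n$; and (3) for all integer sequences $(n(i))$, $(m(i))$ with $n(i)<m(i)+1<n(i+1)$ for all $i$, the sequence $(X[n(i),m(i)])_{i}$ is a finite dimensional decomposition (FDD) of its closed linear span. Boundedly complete: a sequence of subspaces $(F_i)$ is boundedly complete if whenever $x_i\in F_i$ and $(\|\sum_{i=1}^n x_i\|)_n$ is bounded, $\sum x_i$ converges in norm. A boundedly complete SBD is an SBD for which every skipped sequence $(X[n(i),m(i)])_i$ as in (3) is boundedly complete (the whole sequence $(X_n)$ is not required to be boundedly complete). Maps and constant: $p_n:X\to X$ is the bounded projection with range $X_n$ and kernel $[X_m]_{m\neq n}$; $q_n:X\to Z_n=X/[X_m]_{m\ne n}$ is the quotient map; $R_n$ is the projection of $[X_m]_{m\ne n}$ onto $X[1,n-1]$ with kernel $X[n+1,\infty)$. The asymptotic SBD-constant is $K_\infty=\limsup_n\|R_n\|$ (finite for an SBD). Since $X_n$ and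 $Z_n$ are finite dimensional, $p_n^{**}$ maps $X^{**}$ into $X_n$ and $q_n^{**}$ maps $X^{**}$ into $Z_n^{**}=Z_n$. JT-decomposition: a boundedly complete SBD $(X_n)$ is a $c$-norming-JT-decomposition for $X$ if for each $x^{**}\in X^{**}$ with $\liminf_n\|q_n^{**}(x^{**})\|=0$ there is $x\in X$ with $\|x\|\le c\|x^{**}\|$ and $p_n^{**}(x^{**})=p_n(x)$ for all $n$. *)

theory Defs
  imports "HOL-Analysis.Analysis"
begin

text \<open>
  Sequences of subspaces are functions \<open>X :: nat \<Rightarrow> 'a set\<close> indexed by \<open>n \<ge> 1\<close>; the value
  \<open>X 0\<close> is never used.  The Banach space is the whole type \<open>'a\<close>.
\<close>

subsection \<open>Closed spans, decompositions\<close>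

definition findim_subspace :: "'a::real_vector set \<Rightarrow> bool" where
  "findim_subspace S \<longleftrightarrow> (\<exists>B. finite B \<and> span B = S)"

definition closed_span :: "(nat \<Rightarrow> 'a::real_normed_vector set) \<Rightarrow> nat set \<Rightarrow> 'a set" where
  "closed_span X I = closure (span (\<Union>n\<in>I. X n))"

text \<open>\<open>block X m k\<close> is $X[m,k]$; in particular \<open>block X 1 0 = {0}\<close>.\<close>

definition block :: "(nat \<Rightarrow> 'a::real_normed_vector set) \<Rightarrow> nat \<Rightarrow> nat \<Rightarrow> 'a set" where
  "block X m k = closed_span X {m..k}"

text \<open>\<open>tail_span X m\<close> is $X[m,\infty)$.\<close>

definition tail_span :: "(nat \<Rightarrow> 'a::real_normed_vector set) \<Rightarrow> nat \<Rightarrow> 'a set" where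
  "tail_span X m = closed_span X {m..}"

definition others_span :: "(nat \<Rightarrow> 'a::real_normed_vector set) \<Rightarrow> nat \<Rightarrow> 'a set" where
  "others_span X n = closed_span X ({1..} - {n})"

text \<open>A sequence \<open>F\<close> of subspaces (here indexed from \<open>0\<close>) that is an FDD of its own closed
  linear span.\<close>

definition FDD_of_span :: "(nat \<Rightarrow> 'a::real_normed_vector set) \<Rightarrow> bool" where
  "FDD_of_span F \<longleftrightarrow> (\<forall>i. findim_subspace (F i)) \<and>
     (\<forall>y \<in> closed_span F UNIV. \<exists>!f. (\<forall>i. f i \<in> F i) \<and> f sums y)"

definition boundedly_complete :: "(nat \<Rightarrow> 'a::real_normed_vector set) \<Rightarrow> bool" where
  "boundedly_complete F \<longleftrightarrow>
     (\<forall>f. (\<forall>i. f i \<in> F i) \<and> bounded (range (\<lambda>n. \<Sum>i<n. f i)) \<longrightarrow> summable f)"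

definition skipped :: "(nat \<Rightarrow> nat) \<Rightarrow> (nat \<Rightarrow> nat) \<Rightarrow> bool" where
  "skipped n m \<longleftrightarrow> (\<forall>i. 1 \<le> n i \<and> n i < m i + 1 \<and> m i + 1 < n (Suc i))"

definition SBD :: "(nat \<Rightarrow> 'a::real_normed_vector set) \<Rightarrow> bool" where
  "SBD X \<longleftrightarrow> (\<forall>n\<ge>1. findim_subspace (X n)) \<and>
     closed_span X {1..} = UNIV \<and>
     (\<forall>n\<ge>1. X n \<inter> others_span X n = {0}) \<and>
     (\<forall>n m. skipped n m \<longrightarrow> FDD_of_span (\<lambda>i. block X (n i) (m i)))"

definition boundedly_complete_SBD :: "(nat \<Rightarrow> 'a::real_normed_vector set) \<Rightarrow> bool" where
  "boundedly_complete_SBD X \<longleftrightarrow> SBD X \<and>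
     (\<forall>n m. skipped n m \<longrightarrow> boundedly_complete (\<lambda>i. block X (n i) (m i)))"

subsection \<open>Projections and the asymptotic constant\<close>

text \<open>The projection of the direct sum \<open>A + B\<close> onto \<open>A\<close> with kernel \<open>B\<close>; only meaningful on
  \<open>A + B\<close>, and when the sum is direct.\<close>

definition proj_along :: "'a::real_vector set \<Rightarrow> 'a set \<Rightarrow> 'a \<Rightarrow> 'a" where
  "proj_along A B x = (THE a. a \<in> A \<and> x - a \<in> B)"

text \<open>\<open>SBD_p X n\<close> is $p_n$; \<open>SBD_R X n\<close> is $R_n$, with domain \<open>others_span X n\<close>.\<close>

definition SBD_p :: "(nat \<Rightarrow> 'a::real_normed_vector set) \<Rightarrow> nat \<Rightarrow> 'a \<Rightarrow>\<^sub>L 'a" where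
  "SBD_p X n = Blinfun (proj_along (X n) (others_span X n))"

definition SBD_R :: "(nat \<Rightarrow> 'a::real_normed_vector set) \<Rightarrow> nat \<Rightarrow> 'a \<Rightarrow> 'a" where
  "SBD_R X n = proj_along (block X 1 (n - 1)) (tail_span X (n + 1))"

text \<open>The norm of a linear operator \<open>f\<close> on a space with carrier \<open>D\<close> and norm \<open>N\<close>.  The supremum
  is taken in the extended reals.\<close>

definition opnorm_on :: "'d set \<Rightarrow> ('d \<Rightarrow> ereal) \<Rightarrow> ('d \<Rightarrow> 'b::real_normed_vector) \<Rightarrow> ereal" where
  "opnorm_on D N f = (SUP x\<in>{x \<in> D. N x \<le> 1}. ereal (norm (f x)))"

definition asymptotic_constant :: "(nat \<Rightarrow> 'a::real_normed_vector set) \<Rightarrow> ereal" where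
  "asymptotic_constant X =
     limsup (\<lambda>n. opnorm_on (others_span X n) (\<lambda>x. ereal (norm x)) (SBD_R X n))"

subsection \<open>Biduals and quotients\<close>

type_synonym 'a dual = "'a \<Rightarrow>\<^sub>L real"
type_synonym 'a bidual = "'a dual \<Rightarrow>\<^sub>L real"

definition canonical :: "'a::real_normed_vector \<Rightarrow> 'a bidual" where
  "canonical x = Blinfun (\<lambda>f. blinfun_apply f x)"

definition banach_adjoint :: "'a::real_normed_vector \<Rightarrow>\<^sub>L 'b::real_normed_vector \<Rightarrow> 'b dual \<Rightarrow>\<^sub>L 'a dual" where
  "banach_adjoint T = Blinfun (\<lambda>f. f o\<^sub>L T)"

lemma canonical_apply [simp]: "blinfun_apply (canonical x) f = blinfun_apply f x"
  unfolding canonical_def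
  by (simp add: bounded_linear_Blinfun_apply blinfun.bounded_linear_left)

lemma banach_adjoint_apply [simp]: "blinfun_apply (banach_adjoint T) f = f o\<^sub>L T"
  unfolding banach_adjoint_def
  by (simp add: bounded_linear_Blinfun_apply
        bounded_bilinear.bounded_linear_left[OF bounded_bilinear_blinfun_compose])

text \<open>The quotient by a closed subspace \<open>Y\<close> is the set of cosets of \<open>Y\<close>, as a carrier set because
  \<open>Y\<close> will depend on \<open>n\<close>.  Its vector space operations are those making \<open>quotient_proj Y\<close> linear, so a
  functional \<open>\<phi>\<close> on it is linear iff \<open>\<phi> \<circ> quotient_proj Y\<close> is; values of \<open>\<phi>\<close> off the carrier are
  irrelevant.\<close>

definition quotient_proj :: "'a::real_normed_vector set \<Rightarrow> 'a \<Rightarrow> 'a set" where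
  "quotient_proj Y x = (\<lambda>y. x + y) ` Y"

definition quotient_space :: "'a::real_normed_vector set \<Rightarrow> 'a set set" where
  "quotient_space Y = range (quotient_proj Y)"

definition quotient_norm :: "'a::real_normed_vector set \<Rightarrow> ereal" where
  "quotient_norm z = (INF x\<in>z. ereal (norm x))"

definition quotient_dual_norm :: "'a::real_normed_vector set \<Rightarrow> ('a set \<Rightarrow> real) \<Rightarrow> ereal" where
  "quotient_dual_norm Y \<phi> = opnorm_on (quotient_space Y) quotient_norm \<phi>"

definition quotient_dual :: "'a::real_normed_vector set \<Rightarrow> ('a set \<Rightarrow> real) set" where
  "quotient_dual Y = {\<phi>. linear (\<phi> \<circ> quotient_proj Y) \<and> quotient_dual_norm Y \<phi> < \<infinity>}"

text \<open>The adjoint and the second adjoint of the quotient map \<open>quotient_proj Y\<close>.\<close>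

definition quotient_adjoint :: "'a::real_normed_vector set \<Rightarrow> ('a set \<Rightarrow> real) \<Rightarrow> 'a dual" where
  "quotient_adjoint Y \<phi> = Blinfun (\<phi> \<circ> quotient_proj Y)"

definition quotient_biadjoint ::
  "'a::real_normed_vector set \<Rightarrow> 'a bidual \<Rightarrow> ('a set \<Rightarrow> real) \<Rightarrow> real" where
  "quotient_biadjoint Y \<xi> \<phi> = blinfun_apply \<xi> (quotient_adjoint Y \<phi>)"

text \<open>\<open>norm_q_bidual X n \<xi>\<close> is the norm of $q_n^{**}(\xi)$ in $Z_n^{**}$, that is, as a functional
  on the dual of the quotient by \<open>others_span X n\<close>.\<close>

definition norm_q_bidual :: "(nat \<Rightarrow> 'a::real_normed_vector set) \<Rightarrow> nat \<Rightarrow> 'a bidual \<Rightarrow> ereal" where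
  "norm_q_bidual X n \<xi> =
     opnorm_on (quotient_dual (others_span X n)) (quotient_dual_norm (others_span X n))
       (quotient_biadjoint (others_span X n) \<xi>)"

subsection \<open>JT-decompositions\<close>

definition norming_JT_decomposition :: "real \<Rightarrow> (nat \<Rightarrow> 'a::real_normed_vector set) \<Rightarrow> bool" where
  "norming_JT_decomposition c X \<longleftrightarrow> boundedly_complete_SBD X \<and>
     (\<forall>\<xi> :: 'a bidual. liminf (\<lambda>n. norm_q_bidual X n \<xi>) = 0 \<longrightarrow>
        (\<exists>x. norm x \<le> c * norm \<xi> \<and>
             (\<forall>n\<ge>1. blinfun_apply (banach_adjoint (banach_adjoint (SBD_p X n))) \<xi>
                      = canonical (blinfun_apply (SBD_p X n) x))))"

end

theory Submission
  imports Defs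
begin

text \<open>
Let \<open>\<xi>\<close> be in the bidual.  Since each \<open>X n\<close> is finite dimensional, \<open>p\<^sub>n\<close> sends \<open>\<xi>\<close> to an element
\<open>a n\<close> of \<open>X n\<close>, and the task is to find a vector \<open>x\<close> of norm at most \<open>K \<parallel>\<xi>\<parallel>\<close> with components \<open>a n\<close>.

Suppose first that \<open>a k = 0\<close> for all \<open>k\<close> in an infinite set of indices without consecutive elements.
For such \<open>k\<close> the partial sum of the \<open>a i\<close> with \<open>i < k\<close> is the image of \<open>\<xi>\<close> under the second adjoint
of \<open>R\<^sub>k\<close>, hence has norm at most \<open>\<parallel>R\<^sub>k\<parallel> \<parallel>\<xi>\<parallel>\<close> (\<open>norm_component_sum_le\<close>).  These partial sums are bounded and
supported on the blocks between the indices \<open>k\<close>, which are skipped, so bounded completeness makes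
them converge to the required \<open>x\<close>.

In general the components \<open>a k\<close> need not even be small when \<open>q\<^sub>k\<close> of \<open>\<xi>\<close> is, because \<open>X k\<close> may be
nearly contained in the span of the other summands.  But then \<open>a k\<close> is the \<open>k\<close>-th component of some small
vector of finite support (\<open>small_lift\<close>).  A gliding hump construction (\<open>gliding_hump\<close>) produces
summably small vectors whose components vanish at each other's chosen indices; subtracting their sum
from \<open>\<xi>\<close> reduces to the first case.  Moving the first \<open>m\<close> of them back before estimating the \<open>m\<close>-th
partial sum makes the error in the norm vanish in the limit (\<open>bidual_represented\<close>).

That the asymptotic constant is finite is the other use of the gliding hump: if the \<open>R\<^sub>n\<close> were
asymptotically unbounded, a sum of small humps would lie in the closed span of a skipped sequence of
blocks without being the limit of its partial sums there (\<open>partial_projections_bounded\<close>).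

The norm estimates for elements of the bidual rest on the Hahn-Banach theorem for sublinear
functionals, which is proved first.
\<close>

section \<open>Sublinear functionals and the Hahn-Banach theorem\<close>

text \<open>
Only \<open>p (t x) \<le> t p x\<close> for \<open>t > 0\<close> is demanded, since that is what infima satisfy directly;
equality, and \<open>t = 0\<close>, follow by applying the inequality to \<open>1 / t\<close> and to \<open>2\<close>.
\<close>

definition sublinear :: "('a::real_vector \<Rightarrow> real) \<Rightarrow> bool" where
  "sublinear p \<longleftrightarrow> (\<forall>x y. p (x + y) \<le> p x + p y) \<and> (\<forall>t>0. \<forall>x. p (t *\<^sub>R x) \<le> t * p x)"

lemma sublinear_add: "sublinear p \<Longrightarrow> p (x + y) \<le> p x + p y"
  by (simp add: sublinear_def)

lemma sublinear_scale_pos: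
  assumes "sublinear p" "0 < t"
  shows "p (t *\<^sub>R x) = t * p x"
proof (rule antisym)
  show "p (t *\<^sub>R x) \<le> t * p x"
    using assms by (simp add: sublinear_def)
  have "p (inverse t *\<^sub>R (t *\<^sub>R x)) \<le> inverse t * p (t *\<^sub>R x)"
    using assms by (metis sublinear_def inverse_positive_iff_positive)
  then have "p x \<le> inverse t * p (t *\<^sub>R x)"
    using assms by simp
  then show "t * p x \<le> p (t *\<^sub>R x)"
    using assms by (simp add: field_simps)
qed

lemma sublinear_zero: "sublinear p \<Longrightarrow> p 0 = 0"
  using sublinear_scale_pos[of p 2 0] by simp

lemma sublinear_scale: "sublinear p \<Longrightarrow> 0 \<le> t \<Longrightarrow> p (t *\<^sub>R x) = t * p x"
  using sublinear_scale_pos[of p t x] sublinear_zero[of p] by (cases "t = 0") auto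

lemma sublinear_neg: "sublinear p \<Longrightarrow> - p (- x) \<le> p x"
  using sublinear_add[of p x "- x"] sublinear_zero[of p] by simp

text \<open>
Three functionals arise as such marginals over a cone \<open>C\<close>: that of \<open>sublinear_tighten\<close>, with a half
line as cone, the distance to a subspace, and the functional that compares \<open>S n\<close> with the norm in
\<open>norm_component_sum_le\<close>.
\<close>

lemma sublinear_INF:
  fixes F :: "'a::real_vector \<Rightarrow> 'c::real_vector \<Rightarrow> real"
  assumes ne: "C \<noteq> {}"
    and bdd: "\<And>x. bdd_below (F x ` C)"
    and C_add: "\<And>c d. c \<in> C \<Longrightarrow> d \<in> C \<Longrightarrow> c + d \<in> C"
    and C_scale: "\<And>t c. 0 < t \<Longrightarrow> c \<in> C \<Longrightarrow> t *\<^sub>R c \<in> C"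
    and F_add: "\<And>x y c d. c \<in> C \<Longrightarrow> d \<in> C \<Longrightarrow> F (x + y) (c + d) \<le> F x c + F y d"
    and F_scale: "\<And>t x c. 0 < t \<Longrightarrow> c \<in> C \<Longrightarrow> F (t *\<^sub>R x) (t *\<^sub>R c) \<le> t * F x c"
  shows "sublinear (\<lambda>x. INF c\<in>C. F x c)"
  unfolding sublinear_def
proof (intro conjI allI impI)
  fix x y
  have le: "(INF c\<in>C. F (x + y) c) \<le> F x c + F y d" if "c \<in> C" "d \<in> C" for c d
    by (rule order_trans[OF cINF_lower[OF bdd C_add[OF that]] F_add[OF that]])
  have "(INF c\<in>C. F (x + y) c) - F y d \<le> (INF c\<in>C. F x c)" if "d \<in> C" for d
    using ne le[OF _ that] by (intro cINF_greatest) (auto simp: algebra_simps)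
  then have "(INF c\<in>C. F (x + y) c) - (INF c\<in>C. F x c) \<le> (INF c\<in>C. F y c)"
    using ne by (intro cINF_greatest) (auto simp: algebra_simps)
  then show "(INF c\<in>C. F (x + y) c) \<le> (INF c\<in>C. F x c) + (INF c\<in>C. F y c)"
    by simp
next
  fix t :: real and x assume t: "0 < t"
  have "(INF c\<in>C. F (t *\<^sub>R x) c) / t \<le> F x c" if "c \<in> C" for c
    using order_trans[OF cINF_lower[OF bdd C_scale[OF t that]] F_scale[OF t that]] t
    by (simp add: field_simps)
  then have "(INF c\<in>C. F (t *\<^sub>R x) c) / t \<le> (INF c\<in>C. F x c)"
    using ne by (intro cINF_greatest) auto
  then show "(INF c\<in>C. F (t *\<^sub>R x) c) \<le> t * (INF c\<in>C. F x c)"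
    using t by (simp add: field_simps)
qed

text \<open>
The witness is \<open>q x = inf {p (x + t a) - t p a | t \<ge> 0}\<close>: the term \<open>t = 0\<close>, and the term \<open>t = 1\<close> at
\<open>- a\<close> and at \<open>x\<close>, give the three estimates.  If \<open>p\<close> is not additive in the direction \<open>a\<close>, then \<open>q\<close> is
strictly smaller, which is what makes minimal functionals linear.
\<close>

lemma sublinear_tighten:
  assumes p: "sublinear p"
  obtains q where "sublinear q" "\<And>x. q x \<le> p x" "q (- a) \<le> - p a"
    "\<And>x. q x \<le> p (x + a) - p a"
proof -
  define F where "F x t = p (x + t *\<^sub>R a) - t * p a" for x and t :: real
  define q where "q x = (INF t\<in>{0..}. F x t)" for x
  have "- p (- x) \<le> F x t" if "0 \<le> t" for x t
    using sublinear_add[OF p, of "x + t *\<^sub>R a" "- x"] sublinear_scale[OF p that, of a]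
    by (simp add: F_def)
  then have bdd: "bdd_below (F x ` {0..})" for x
    by (intro bdd_belowI2[where m = "- p (- x)"]) auto
  have "sublinear q"
    unfolding q_def
  proof (rule sublinear_INF[OF _ bdd])
    fix x y :: 'a and c d :: real
    show "F (x + y) (c + d) \<le> F x c + F y d"
      using sublinear_add[OF p, of "x + c *\<^sub>R a" "y + d *\<^sub>R a"]
      by (simp add: F_def algebra_simps)
  next
    fix t c :: real and x :: 'a assume "0 < t"
    then show "F (t *\<^sub>R x) (t *\<^sub>R c) \<le> t * F x c"
      using sublinear_scale_pos[OF p, of t "x + c *\<^sub>R a"] by (simp add: F_def algebra_simps)
  qed auto
  moreover have low: "q x \<le> F x t" if "0 \<le> t" for x t
    unfolding q_def by (rule cINF_lower[OF bdd]) (use that in auto)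
  moreover have "q x \<le> p x" for x
    using low[of 0 x] by (simp add: F_def)
  moreover have "q (- a) \<le> - p a"
    using low[of 1 "- a"] sublinear_zero[OF p] by (simp add: F_def)
  moreover have "q x \<le> p (x + a) - p a" for x
    using low[of 1 x] by (simp add: F_def)
  ultimately show thesis using that by blast
qed

text \<open>
Zorn's lemma applies because a chain of sublinear functionals below \<open>p\<close> has a finite pointwise
infimum, every member being bounded below at \<open>x\<close> by \<open>- p (- x)\<close>.
\<close>

lemma minimal_sublinear_exists:
  assumes p: "sublinear p"
  obtains q where "sublinear q" "\<And>x. q x \<le> p x"
    "\<And>r. sublinear r \<Longrightarrow> (\<And>x. r x \<le> q x) \<Longrightarrow> r = q"
proof -
  define A where "A = {q. sublinear q \<and> (\<forall>x. q x \<le> p x)}"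
  define P :: "('a \<Rightarrow> real) \<Rightarrow> ('a \<Rightarrow> real) \<Rightarrow> bool" where "P q r \<longleftrightarrow> (\<forall>x. r x \<le> q x)" for q r
  have po: "partial_order_on A (relation_of P A)"
    unfolding partial_order_on_def preorder_on_def refl_on_def trans_def antisym_def relation_of_def
  proof (intro conjI allI impI ballI subsetI; clarsimp)
    show "P q q" for q by (simp add: P_def)
    show "P q s" if "P q r" "P r s" for q r s
      using that by (auto simp: P_def intro: order_trans)
    show "q = r" if "P q r" "P r q" for q r
      using that by (intro ext antisym) (auto simp: P_def)
  qed
  have "\<exists>m\<in>A. \<forall>a\<in>A. P m a \<longrightarrow> a = m"
  proof (rule predicate_Zorn[OF po])
    fix C assume "C \<in> Chains (relation_of P A)"
    then have CA: "C \<subseteq> A" and chain: "\<And>q r. q \<in> C \<Longrightarrow> r \<in> C \<Longrightarrow> P q r \<or> P r q"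
      by (auto simp: Chains_def relation_of_def)
    show "\<exists>u\<in>A. \<forall>a\<in>C. P a u"
    proof (cases "C = {}")
      case True
      then show ?thesis using p by (auto simp: A_def)
    next
      case False
      define u where "u x = (INF q\<in>C. q x)" for x
      have "- p (- x) \<le> q x" if "q \<in> C" for q x
      proof -
        have "sublinear q" "q (- x) \<le> p (- x)"
          using CA that by (auto simp: A_def)
        then show ?thesis using sublinear_neg[of q x] by linarith
      qed
      then have bdd: "bdd_below ((\<lambda>q. q x) ` C)" for x
        by (rule bdd_belowI2)
      have low: "u x \<le> q x" if "q \<in> C" for q x
        unfolding u_def by (rule cINF_lower[OF bdd that])
      have "u (x + y) \<le> u x + u y" for x y
      proof -
        have *: "u (x + y) \<le> q x + r y" if qr: "q \<in> C" "r \<in> C" for q r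
        proof -
          obtain s where s: "s \<in> C" "s x \<le> q x" "s y \<le> r y"
            using chain[OF qr] qr unfolding P_def by blast
          then have "sublinear s" using CA by (auto simp: A_def)
          then show ?thesis
            using low[OF s(1), of "x + y"] sublinear_add[of s x y] s by linarith
        qed
        have "u (x + y) - r y \<le> u x" if "r \<in> C" for r
          unfolding u_def[of x] using False *[OF _ that]
          by (intro cINF_greatest) (auto simp: algebra_simps)
        then have "u (x + y) - u x \<le> u y"
          unfolding u_def[of y] using False by (intro cINF_greatest) (auto simp: algebra_simps)
        then show ?thesis by simp
      qed
      moreover have "u (t *\<^sub>R x) \<le> t * u x" if t: "0 < t" for t x
      proof -
        have "u (t *\<^sub>R x) / t \<le> q x" if "q \<in> C" for q
          using low[OF that, of "t *\<^sub>R x"] sublinear_scale_pos[of q t x] t that CA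
          by (auto simp: A_def field_simps)
        then have "u (t *\<^sub>R x) / t \<le> u x"
          unfolding u_def[of x] using False by (intro cINF_greatest) auto
        then show ?thesis using t by (simp add: field_simps)
      qed
      moreover have "u x \<le> p x" for x
      proof -
        obtain q where "q \<in> C" using False by blast
        then have "u x \<le> q x" "q x \<le> p x" using low CA by (auto simp: A_def)
        then show ?thesis by (rule order_trans)
      qed
      ultimately have "u \<in> A" by (simp add: A_def sublinear_def)
      then show ?thesis using low by (auto simp: P_def)
    qed
  qed
  then obtain q where "q \<in> A" "\<forall>a\<in>A. P q a \<longrightarrow> a = q" by blast
  moreover have "r \<in> A" if "sublinear r" "\<And>x. r x \<le> q x" for r
  proof -
    have "r x \<le> p x" for x
      using that(2)[of x] \<open>q \<in> A\<close> by (auto simp: A_def intro: order_trans[of "r x" "q x"])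
    then show ?thesis using that(1) by (simp add: A_def)
  qed
  moreover have "sublinear q" "\<And>x. q x \<le> p x"
    using \<open>q \<in> A\<close> by (simp_all add: A_def)
  ultimately show thesis
    using that[of q] unfolding P_def by blast
qed

text \<open>
A minimal sublinear functional is linear: tightening it at \<open>y\<close> cannot lower it, so
\<open>q x \<le> q (x + y) - q y\<close>, which together with subadditivity is additivity.  Tightening \<open>p\<close> at \<open>a\<close>
before minimising makes the linear functional attain \<open>p a\<close>.
\<close>

lemma Hahn_Banach_sublinear:
  assumes p: "sublinear p"
  obtains g where "linear g" "\<And>x. g x \<le> p x" "g a = p a"
proof -
  obtain r where r: "sublinear r" "\<And>x. r x \<le> p x" "r (- a) \<le> - p a"
    using sublinear_tighten[OF p, of a] by metis
  obtain q where q: "sublinear q" "\<And>x. q x \<le> r x"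
    and minimal: "\<And>s. sublinear s \<Longrightarrow> (\<And>x. s x \<le> q x) \<Longrightarrow> s = q"
    using minimal_sublinear_exists[OF r(1)] by metis
  have add: "q (x + y) = q x + q y" for x y
  proof -
    obtain s where s: "sublinear s" "\<And>z. s z \<le> q z" "\<And>z. s z \<le> q (z + y) - q y"
      using sublinear_tighten[OF q(1), of y] by metis
    then have "q x \<le> q (x + y) - q y"
      using minimal[OF s(1,2)] by auto
    then show ?thesis
      using sublinear_add[OF q(1), of x y] by simp
  qed
  have neg: "q (- x) = - q x" for x
    using add[of x "- x"] sublinear_zero[OF q(1)] by simp
  have "linear q"
  proof (rule linearI[OF add])
    fix t x
    show "q (t *\<^sub>R x) = t *\<^sub>R q x"
      using sublinear_scale[OF q(1), of t x] sublinear_scale[OF q(1), of "- t" x] neg[of "t *\<^sub>R x"]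
      by (cases "0 \<le> t") auto
  qed
  moreover have le: "q x \<le> p x" for x
    using q(2) r(2) order_trans by blast
  moreover have "q a = p a"
    using le[of a] q(2)[of "- a"] r(3) neg[of a] by simp
  ultimately show thesis by (rule that)
qed

lemma Hahn_Banach_dominated:
  fixes p :: "'a::real_normed_vector \<Rightarrow> real"
  assumes p: "sublinear p" and C0: "0 \<le> C" and C: "\<And>x. p x \<le> C * norm x"
  obtains g :: "'a dual" where "\<And>x. g x \<le> p x" "g a = p a" "norm g \<le> C"
proof -
  obtain g where g: "linear g" "\<And>x. g x \<le> p x" "g a = p a"
    using Hahn_Banach_sublinear[OF p] by metis
  have abs: "norm (g x) \<le> C * norm x" for x
    using g(2)[of x] g(2)[of "- x"] C[of x] C[of "- x"] linear_neg[OF g(1), of x] by simp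
  then have bl: "bounded_linear g"
    using g(1) by (intro bounded_linear.intro) (auto simp: bounded_linear_axioms_def mult.commute)
  show thesis
  proof (rule that[of "Blinfun g"])
    show "norm (Blinfun g) \<le> C"
    proof (rule norm_blinfun_bound)
      show "0 \<le> C" by (rule C0)
      show "norm (Blinfun g x) \<le> C * norm x" for x
        using abs bl by (simp add: bounded_linear_Blinfun_apply)
    qed
  qed (use g bl in \<open>simp_all add: bounded_linear_Blinfun_apply\<close>)
qed

section \<open>Finite dimensional subspaces of normed spaces\<close>

lemma subspace_closure:
  fixes S :: "'a::real_normed_vector set"
  assumes "subspace S" shows "subspace (closure S)"
  unfolding subspace_def
proof (intro conjI ballI allI)
  show "0 \<in> closure S"
    using closure_subset subspace_0[OF assms] by blast
  show "x + y \<in> closure S" if xy: "x \<in> closure S" "y \<in> closure S" for x y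
  proof -
    obtain f g where fg: "\<And>n. f n \<in> S" "f \<longlonglongrightarrow> x" "\<And>n. g n \<in> S" "g \<longlonglongrightarrow> y"
      using xy unfolding closure_sequential by blast
    then have "\<forall>n. f n + g n \<in> S" "(\<lambda>n. f n + g n) \<longlonglongrightarrow> x + y"
      using subspace_add[OF assms] by (auto intro: tendsto_add)
    then show ?thesis
      unfolding closure_sequential by (intro exI[of _ "\<lambda>n. f n + g n"]) simp
  qed
  show "c *\<^sub>R x \<in> closure S" if x: "x \<in> closure S" for c x
  proof -
    obtain f where "\<And>n. f n \<in> S" "f \<longlonglongrightarrow> x"
      using x unfolding closure_sequential by blast
    then have "\<forall>n. c *\<^sub>R f n \<in> S" "(\<lambda>n. c *\<^sub>R f n) \<longlonglongrightarrow> c *\<^sub>R x"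
      using subspace_scale[OF assms] by (auto intro: tendsto_intros)
    then show ?thesis
      unfolding closure_sequential by (intro exI[of _ "\<lambda>n. c *\<^sub>R f n"]) simp
  qed
qed

lemma sublinear_infdist:
  fixes Y :: "'a::real_normed_vector set"
  assumes Y: "subspace Y"
  shows "sublinear (\<lambda>x. infdist x Y)"
proof -
  have ne: "Y \<noteq> {}" using subspace_0[OF Y] by auto
  have "sublinear (\<lambda>x. INF y\<in>Y. norm (x - y))"
  proof (rule sublinear_INF[OF ne])
    show "bdd_below ((\<lambda>y. norm (x - y)) ` Y)" for x
      by (rule bdd_belowI2[where m = 0]) simp
    show "norm (x + y - (c + d)) \<le> norm (x - c) + norm (y - d)" for x y c d :: 'a
      by (metis add_diff_add norm_triangle_ineq)
    show "norm (t *\<^sub>R x - t *\<^sub>R c) \<le> t * norm (x - c)" if "0 < t" for t and x c :: 'a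
      using that by (simp flip: scaleR_diff_right)
  qed (use Y in \<open>auto simp: subspace_add subspace_scale\<close>)
  then show ?thesis
    using ne by (simp add: infdist_def dist_norm)
qed

text \<open>
Hahn-Banach for the distance to \<open>Y\<close>, which vanishes on \<open>Y\<close> and is at most the norm.
\<close>

lemma infdist_functional:
  fixes Y :: "'a::real_normed_vector set"
  assumes Y: "subspace Y"
  obtains g :: "'a dual" where "g a = infdist a Y" "norm g \<le> 1" "\<And>y. y \<in> Y \<Longrightarrow> g y = 0"
proof -
  have le: "infdist x Y \<le> 1 * norm x" for x
    using infdist_le[OF subspace_0[OF Y], of x] by simp
  obtain g :: "'a dual" where g: "\<And>x. g x \<le> infdist x Y" "g a = infdist a Y" "norm g \<le> 1"
    using Hahn_Banach_dominated[OF sublinear_infdist[OF Y] _ le] by (metis zero_le_one)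
  have "g y = 0" if y: "y \<in> Y" for y
    using g(1)[of y] g(1)[of "- y"] y subspace_neg[OF Y y] by (simp add: blinfun.minus_right)
  then show thesis using g that by blast
qed

lemma abs_scale_infdist_le:
  fixes Y :: "'a::real_normed_vector set"
  assumes Y: "subspace Y" and y: "y \<in> Y"
  shows "\<bar>t\<bar> * infdist v Y \<le> norm (y + t *\<^sub>R v)"
proof -
  obtain g :: "'a dual" where g: "g v = infdist v Y" "norm g \<le> 1" "\<And>y. y \<in> Y \<Longrightarrow> g y = 0"
    using infdist_functional[OF Y, of v] by metis
  have "\<bar>t\<bar> * infdist v Y = norm (g (y + t *\<^sub>R v))"
    by (simp add: blinfun.add_right blinfun.scaleR_right g y abs_mult infdist_nonneg)
  also have "\<dots> \<le> norm g * norm (y + t *\<^sub>R v)"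
    by (rule norm_blinfun)
  also have "\<dots> \<le> norm (y + t *\<^sub>R v)"
    using g(2) by (simp add: mult_left_le_one_le)
  finally show ?thesis .
qed

text \<open>
If \<open>v\<close> is not in the closed subspace, a functional vanishing there but not at \<open>v\<close> recovers the
coefficient of \<open>v\<close> continuously, so that membership in the larger span is a closed condition.
\<close>

lemma closed_span_insert:
  fixes Y :: "'a::real_normed_vector set"
  assumes Y: "closed (span Y)"
  shows "closed (span (insert v Y))"
proof (cases "v \<in> span Y")
  case True
  then have "span (insert v Y) = span Y" by (rule span_redundant)
  with Y show ?thesis by simp
next
  case False
  obtain g :: "'a dual" where g: "g v = infdist v (span Y)" "norm g \<le> 1"
    "\<And>y. y \<in> span Y \<Longrightarrow> g y = 0"
    using infdist_functional[OF subspace_span, of v Y] by metis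
  have d: "g v \<noteq> 0"
    using in_closed_iff_infdist_zero[OF Y, of v] False g(1) span_zero[of Y] by auto
  have "span (insert v Y) = {x. x - (g x / g v) *\<^sub>R v \<in> span Y}"
  proof (intro set_eqI iffI; clarsimp)
    fix x assume "x \<in> span (insert v Y)"
    then obtain k where k: "x - k *\<^sub>R v \<in> span Y"
      by (auto simp: span_insert)
    then have "g x = k * g v"
      using g(3)[OF k] by (simp add: blinfun.diff_right blinfun.scaleR_right)
    then show "x - (g x / g v) *\<^sub>R v \<in> span Y"
      using k d by simp
  next
    fix x assume "x - (g x / g v) *\<^sub>R v \<in> span Y"
    then show "x \<in> span (insert v Y)"
      by (auto simp: span_insert)
  qed
  also have "\<dots> = (\<lambda>x. x - (g x / g v) *\<^sub>R v) -` span Y"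
    by auto
  also have "closed \<dots>"
    using d by (intro continuous_closed_vimage Y continuous_intros) auto
  finally show ?thesis .
qed

lemma closed_span_Un_finite:
  fixes Y :: "'a::real_normed_vector set"
  assumes "closed (span Y)" "finite B"
  shows "closed (span (B \<union> Y))"
  using assms(2) by (induction B) (auto simp: assms(1) closed_span_insert)

lemma closed_span_finite:
  fixes B :: "'a::real_normed_vector set"
  shows "finite B \<Longrightarrow> closed (span B)"
  using closed_span_Un_finite[of "{}" B] by simp

text \<open>
This bounds the projection onto \<open>span B\<close> along \<open>Y\<close>.  One vector \<open>v\<close> is added at a time: its coefficient is controlled by the distance from
\<open>v\<close> to the closed span of the previous vectors and \<open>Y\<close>.
\<close>

lemma complemented_finite_bound:
  fixes Y :: "'a::real_normed_vector set"
  assumes Y: "subspace Y" "closed Y" and "finite B" "span B \<inter> Y \<subseteq> {0}"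
  shows "\<exists>c. \<forall>b\<in>span B. \<forall>y\<in>Y. norm b \<le> c * norm (y + b)"
  using assms(3,4)
proof (induction B)
  case empty
  show ?case by (auto intro: exI[of _ 0])
next
  case (insert v B)
  have sub: "span B \<subseteq> span (insert v B)"
    by (rule span_mono) auto
  obtain c where c: "\<And>b y. b \<in> span B \<Longrightarrow> y \<in> Y \<Longrightarrow> norm b \<le> c * norm (y + b)"
    using insert.IH insert.prems sub by blast
  show ?case
  proof (cases "v \<in> span B")
    case True
    then show ?thesis using c by (metis span_redundant)
  next
    case False
    define W where "W = span (B \<union> Y)"
    have W: "subspace W" "closed W"
      using closed_span_Un_finite[of Y B] Y insert.hyps
      by (simp_all add: W_def span_eq_iff[THEN iffD2])
    have "v \<notin> W"
    proof
      assume "v \<in> W"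
      then obtain b y where "v = b + y" "b \<in> span B" "y \<in> Y"
        using span_eq_iff[THEN iffD2, OF Y(1)] by (auto simp: W_def span_Un)
      moreover have "v - b \<in> span (insert v B)"
        using sub \<open>b \<in> span B\<close> by (intro span_diff) (auto simp: span_base)
      ultimately have "y = 0"
        using insert.prems by (auto simp: algebra_simps)
      then show False
        using False \<open>v = b + y\<close> \<open>b \<in> span B\<close> by simp
    qed
    then have d: "0 < infdist v W"
      using W subspace_0[OF W(1)] infdist_pos_not_in_closed by blast
    define C where "C = \<bar>c\<bar> * (1 + norm v / infdist v W) + norm v / infdist v W"
    have "norm b' \<le> C * norm (y + b')" if b': "b' \<in> span (insert v B)" and y: "y \<in> Y" for b' y
    proof -
      obtain t where t: "b' - t *\<^sub>R v \<in> span B"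
        using b' by (auto simp: span_insert)
      define b where "b = b' - t *\<^sub>R v"
      have b: "b \<in> span B" and b'_eq: "b' = b + t *\<^sub>R v"
        using t by (simp_all add: b_def)
      have "y + b \<in> W"
        using b y Y(1) unfolding W_def by (metis span_Un add.commute span_add span_mono span_base Un_upper1 Un_upper2 subsetD)
      then have "\<bar>t\<bar> * infdist v W \<le> norm (y + b')"
        using abs_scale_infdist_le[OF W(1), of "y + b" t v] by (simp add: b'_eq add.assoc)
      then have "\<bar>t\<bar> \<le> norm (y + b') / infdist v W"
        using d by (simp add: field_simps)
      then have "\<bar>t\<bar> * norm v \<le> norm (y + b') / infdist v W * norm v"
        by (rule mult_right_mono) simp
      then have tv: "norm (t *\<^sub>R v) \<le> norm v / infdist v W * norm (y + b')"
        by (simp add: mult.commute)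
      have "norm (y + b) \<le> norm (y + b') + norm (t *\<^sub>R v)"
        using norm_triangle_ineq4[of "y + b'" "t *\<^sub>R v"] by (simp add: b'_eq algebra_simps)
      also have "\<dots> \<le> (1 + norm v / infdist v W) * norm (y + b')"
        using tv by (simp add: algebra_simps)
      finally have yb: "norm (y + b) \<le> (1 + norm v / infdist v W) * norm (y + b')" .
      have "norm b' \<le> norm b + norm (t *\<^sub>R v)"
        unfolding b'_eq by (rule norm_triangle_ineq)
      also have "norm b \<le> \<bar>c\<bar> * norm (y + b)"
        by (rule order_trans[OF c[OF b y]]) (simp add: mult_right_mono)
      also have "\<dots> \<le> \<bar>c\<bar> * ((1 + norm v / infdist v W) * norm (y + b'))"
        using yb by (rule mult_left_mono) simp
      finally show ?thesis
        using tv by (simp add: C_def algebra_simps)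
    qed
    then show ?thesis by blast
  qed
qed

text \<open>
The second adjoint of a finite rank operator maps the bidual into the range: its value at \<open>\<xi>\<close> is
the canonical image of some \<open>a\<close>.  Induction on the spanning set: with a functional \<open>g\<close> vanishing on
\<open>span B\<close> but not at \<open>v\<close>, subtracting the rank one operator \<open>x \<mapsto> (g (P x) / g v) v\<close> from \<open>P\<close> leaves an
operator with range in \<open>span B\<close>.
\<close>

lemma finite_rank_bidual:
  fixes \<xi> :: "('a::real_normed_vector) bidual" and P :: "'a \<Rightarrow>\<^sub>L 'a"
  assumes "finite B" "range P \<subseteq> span B"
  shows "\<exists>a\<in>span B. \<forall>f. \<xi> (f o\<^sub>L P) = f a"
  using assms
proof (induction B arbitrary: P)
  case empty
  then have "f o\<^sub>L P = 0" for f :: "'a dual"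
    by (intro blinfun_eqI) (auto simp: image_subset_iff)
  then show ?case by auto
next
  case (insert v B)
  show ?case
  proof (cases "v \<in> span B")
    case True
    then show ?thesis using insert.IH[of P] insert.prems by (simp add: span_redundant)
  next
    case False
    obtain g :: "'a dual" where g: "g v = infdist v (span B)" "\<And>y. y \<in> span B \<Longrightarrow> g y = 0"
      using infdist_functional[OF subspace_span, of v B] by metis
    have d: "g v \<noteq> 0"
      using in_closed_iff_infdist_zero[OF closed_span_finite[OF insert.hyps(1)], of v] False g(1)
        span_zero[of B] by auto
    define Q where "Q = P - (blinfun_scaleR_left ((1 / g v) *\<^sub>R v) o\<^sub>L (g o\<^sub>L P))"
    have Q: "Q x = P x - (g (P x) / g v) *\<^sub>R v" for x
      by (simp add: Q_def blinfun.diff_left)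
    have "range Q \<subseteq> span B"
    proof (clarsimp simp: Q)
      fix x
      obtain k where k: "P x - k *\<^sub>R v \<in> span B"
        using insert.prems by (auto simp: span_insert)
      have "g (P x) = k * g v"
        using g(2)[OF k] by (simp add: blinfun.diff_right blinfun.scaleR_right)
      then show "P x - (g (P x) / g v) *\<^sub>R v \<in> span B"
        using k d by simp
    qed
    then obtain a where a: "a \<in> span B" "\<And>f. \<xi> (f o\<^sub>L Q) = f a"
      using insert.IH by blast
    define a' where "a' = a + (\<xi> (g o\<^sub>L P) / g v) *\<^sub>R v"
    have "\<xi> (f o\<^sub>L P) = f a'" for f
    proof -
      have "f o\<^sub>L P = (f o\<^sub>L Q) + (f v / g v) *\<^sub>R (g o\<^sub>L P)"
        by (rule blinfun_eqI)
          (simp add: Q blinfun.add_left blinfun.scaleR_left blinfun.diff_right blinfun.scaleR_right)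
      then show ?thesis
        by (simp add: a a'_def blinfun.add_right blinfun.scaleR_right)
    qed
    moreover have "a' \<in> span (insert v B)"
      using a(1) subsetD[OF span_mono[of B "insert v B"]] unfolding a'_def
      by (intro span_add span_scale) (auto intro: span_base)
    ultimately show ?thesis by blast
  qed
qed

section \<open>The projections of a skipped-blocking decomposition\<close>

lemma subspace_closed_span: "subspace (closed_span X I)"
  by (simp add: closed_span_def subspace_closure)

lemma closed_closed_span: "closed (closed_span X I)"
  by (simp add: closed_span_def)

lemma summand_subset_closed_span: "i \<in> I \<Longrightarrow> X i \<subseteq> closed_span X I"
  unfolding closed_span_def
  by (intro order_trans[OF _ closure_subset] order_trans[OF _ span_superset]) auto

lemma closed_span_subset:
  assumes "subspace W" "closed W" "\<And>i. i \<in> I \<Longrightarrow> X i \<subseteq> W"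
  shows "closed_span X I \<subseteq> W"
  unfolding closed_span_def
  using assms by (intro closure_minimal span_minimal UN_least)

lemma proj_along_eqI:
  assumes "subspace A" "subspace B" "A \<inter> B \<subseteq> {0}" "a \<in> A" "x - a \<in> B"
  shows "proj_along A B x = a"
  unfolding proj_along_def
proof (rule the_equality)
  show "a \<in> A \<and> x - a \<in> B" using assms by simp
  fix b assume b: "b \<in> A \<and> x - b \<in> B"
  have "b - a \<in> A" using b assms by (simp add: subspace_diff)
  moreover have "(x - a) - (x - b) \<in> B"
    using b assms(5) by (blast intro: subspace_diff[OF assms(2)])
  ultimately have "b - a \<in> A \<inter> B" by simp
  then show "b = a" using assms(3) by auto
qed

lemma subspace_equaliser:
  fixes f g :: "'a::real_normed_vector \<Rightarrow>\<^sub>L 'b::real_normed_vector"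
  shows "subspace {x. f x = g x}"
  by (auto simp: subspace_def blinfun.add_right blinfun.scaleR_right)

lemma closed_equaliser:
  fixes f g :: "'a::real_normed_vector \<Rightarrow>\<^sub>L 'b::real_normed_vector"
  shows "closed {x. f x = g x}"
  by (intro closed_Collect_eq continuous_intros)

locale skipped_blocking_decomposition =
  fixes X :: "nat \<Rightarrow> 'a::banach set"
  assumes SBD: "SBD X"
begin

lemma findim: "1 \<le> n \<Longrightarrow> \<exists>B. finite B \<and> span B = X n"
  using SBD by (auto simp: SBD_def findim_subspace_def)

lemma subspace_X: "1 \<le> n \<Longrightarrow> subspace (X n)"
  using findim by (metis subspace_span)

text \<open>
Since \<open>X n\<close> is finite dimensional, its sum with the closed span of the other summands is closed, so
it is the whole space, and the projection is bounded.  So \<open>Blinfun\<close> in the definition of \<open>SBD_p\<close> is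
applied to a bounded linear function, and \<open>SBD_p\<close> has the defining properties of a projection.
\<close>

lemma
  assumes n: "1 \<le> n"
  shows SBD_p_in: "SBD_p X n x \<in> X n"
    and diff_SBD_p_in: "x - SBD_p X n x \<in> others_span X n"
    and SBD_p_eqI: "a \<in> X n \<Longrightarrow> x - a \<in> others_span X n \<Longrightarrow> SBD_p X n x = a"
proof -
  obtain B where B: "finite B" "span B = X n"
    using findim[OF n] by blast
  define Y where "Y = others_span X n"
  have Y: "subspace Y" "closed Y"
    by (simp_all add: Y_def others_span_def subspace_closed_span closed_closed_span)
  have XY: "X n \<inter> Y \<subseteq> {0}"
    using SBD n by (auto simp: SBD_def Y_def)
  have spanY: "span Y = Y"
    using Y(1) span_eq_iff by blast
  have "closed_span X {1..} \<subseteq> span (B \<union> Y)"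
  proof (rule closed_span_subset)
    show "closed (span (B \<union> Y))"
      using closed_span_Un_finite[OF _ B(1), of Y] Y spanY by simp
    fix i :: nat assume i: "i \<in> {1..}"
    show "X i \<subseteq> span (B \<union> Y)"
    proof (cases "i = n")
      case True
      then show ?thesis using B(2) span_mono[of B "B \<union> Y"] by auto
    next
      case False
      then have "X i \<subseteq> Y"
        using i summand_subset_closed_span[of i "{1..} - {n}" X]
        by (auto simp: Y_def others_span_def)
      then show ?thesis using span_superset[of "B \<union> Y"] by blast
    qed
  qed simp
  then have univ: "span (B \<union> Y) = UNIV"
    using SBD by (auto simp: SBD_def)
  have ex: "\<exists>a. a \<in> X n \<and> x - a \<in> Y" for x
  proof -
    have "x \<in> span (B \<union> Y)" using univ by simp
    then obtain b y where "x = b + y" "b \<in> span B" "y \<in> span Y"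
      unfolding span_Un by blast
    then show ?thesis using B(2) spanY by (intro exI[of _ b]) simp
  qed
  let ?P = "proj_along (X n) Y"
  have P: "?P x = a" if "a \<in> X n" "x - a \<in> Y" for x a
    using proj_along_eqI[OF subspace_X[OF n] Y(1) XY that] .
  have P_in: "?P x \<in> X n" "x - ?P x \<in> Y" for x
    using ex[of x] P by auto
  obtain c where c: "\<And>b y. b \<in> X n \<Longrightarrow> y \<in> Y \<Longrightarrow> norm b \<le> c * norm (y + b)"
    using complemented_finite_bound[OF Y B(1)] XY unfolding B(2) by blast
  have bl: "bounded_linear ?P"
  proof (rule bounded_linear_intro)
    show "?P (x + y) = ?P x + ?P y" for x y
      using subspace_add[OF subspace_X[OF n] P_in(1)[of x] P_in(1)[of y]]
        subspace_add[OF Y(1) P_in(2)[of x] P_in(2)[of y]]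
      by (intro P) (simp_all add: algebra_simps)
    show "?P (r *\<^sub>R x) = r *\<^sub>R ?P x" for r x
      using subspace_scale[OF subspace_X[OF n] P_in(1)[of x], of r]
        subspace_scale[OF Y(1) P_in(2)[of x], of r]
      by (intro P) (simp_all add: algebra_simps)
    show "norm (?P x) \<le> norm x * c" for x
      using c[OF P_in(1)[of x] P_in(2)[of x]] by (simp add: mult.commute)
  qed
  then have eq: "SBD_p X n x = ?P x" for x
    by (simp add: SBD_p_def Y_def bounded_linear_Blinfun_apply)
  show "SBD_p X n x \<in> X n" "x - SBD_p X n x \<in> others_span X n"
    using P_in eq by (simp_all add: Y_def)
  show "a \<in> X n \<Longrightarrow> x - a \<in> others_span X n \<Longrightarrow> SBD_p X n x = a"
    using P eq by (simp add: Y_def)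
qed

lemma SBD_p_same: "1 \<le> n \<Longrightarrow> x \<in> X n \<Longrightarrow> SBD_p X n x = x"
  by (rule SBD_p_eqI) (simp_all add: others_span_def subspace_0 subspace_closed_span)

lemma others_span_iff: "1 \<le> n \<Longrightarrow> x \<in> others_span X n \<longleftrightarrow> SBD_p X n x = 0"
  using SBD_p_eqI[of n 0 x] diff_SBD_p_in[of n x] subspace_0[OF subspace_X[of n]] by auto

lemma SBD_p_other:
  assumes "1 \<le> i" "1 \<le> n" "i \<noteq> n" "x \<in> X i"
  shows "SBD_p X n x = 0"
  using assms summand_subset_closed_span[of i "{1..} - {n}" X]
  by (auto simp: others_span_iff[symmetric] others_span_def)

lemma SBD_p_comp:
  assumes "1 \<le> i" "1 \<le> j"
  shows "SBD_p X i (SBD_p X j x) = (if i = j then SBD_p X j x else 0)"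
  using assms SBD_p_other[OF _ _ _ SBD_p_in] SBD_p_same[OF _ SBD_p_in] by auto

text \<open>
\<open>S n\<close> is the natural projection onto the span of the first \<open>n - 1\<close> summands.  Its norms may be
unbounded in \<open>n\<close>: for an SBD only its restriction to the kernel of the next projection
\<open>SBD_p X n\<close> is controlled, and there it is \<open>R\<^sub>n\<close> by \<open>SBD_R_eq_S\<close> below.
\<close>

definition S :: "nat \<Rightarrow> 'a \<Rightarrow>\<^sub>L 'a" where
  "S n = (\<Sum>i\<in>{1..<n}. SBD_p X i)"

lemma S_apply: "S n x = (\<Sum>i\<in>{1..<n}. SBD_p X i x)"
  by (simp add: S_def blinfun.sum_left)

lemma S_Suc: "1 \<le> n \<Longrightarrow> S (Suc n) x = S n x + SBD_p X n x"
  by (simp add: S_apply)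

lemma S_X:
  assumes "1 \<le> i" "x \<in> X i"
  shows "S n x = (if i < n then x else 0)"
proof -
  have "S n x = (\<Sum>j\<in>{1..<n}. if i = j then x else 0)"
    unfolding S_apply using assms
    by (intro sum.cong) (auto simp: SBD_p_same SBD_p_other)
  then show ?thesis using assms by simp
qed

lemma SBD_p_closed_span_eq_0:
  assumes "1 \<le> n" "I \<subseteq> {1..}" "n \<notin> I" "x \<in> closed_span X I"
  shows "SBD_p X n x = 0"
proof -
  have "closed_span X I \<subseteq> {x. SBD_p X n x = (0 :: 'a \<Rightarrow>\<^sub>L 'a) x}"
  proof (intro closed_span_subset subspace_equaliser closed_equaliser)
    fix i assume "i \<in> I"
    then have "1 \<le> i" "i \<noteq> n" using assms by auto
    then show "X i \<subseteq> {x. SBD_p X n x = (0 :: 'a \<Rightarrow>\<^sub>L 'a) x}"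
      using SBD_p_other assms(1) by auto
  qed
  then show ?thesis using assms(4) by auto
qed

lemma S_closed_span_below:
  assumes "I \<subseteq> {1..<n}" "x \<in> closed_span X I"
  shows "S n x = x"
proof -
  have "closed_span X I \<subseteq> {x. S n x = id_blinfun x}"
    using assms(1) by (intro closed_span_subset subspace_equaliser closed_equaliser)
      (auto simp: S_X subset_iff)
  then show ?thesis using assms(2) by auto
qed

lemma S_closed_span_above:
  assumes "I \<subseteq> {n..}" "1 \<le> n" "x \<in> closed_span X I"
  shows "S n x = 0"
  using assms unfolding S_apply
  by (intro sum.neutral ballI SBD_p_closed_span_eq_0[where I = I]) auto

lemma S_in_closed_span:
  assumes "\<And>i. 1 \<le> i \<Longrightarrow> i < n \<Longrightarrow> i \<notin> I \<Longrightarrow> SBD_p X i x = 0"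
  shows "S n x \<in> closed_span X I"
  unfolding S_apply
proof (intro subspace_sum subspace_closed_span)
  fix i assume i: "i \<in> {1..<n}"
  show "SBD_p X i x \<in> closed_span X I"
  proof (cases "i \<in> I")
    case True
    then show ?thesis using i SBD_p_in[of i x] summand_subset_closed_span by fastforce
  next
    case False
    then show ?thesis using i assms subspace_0[OF subspace_closed_span] by simp
  qed
qed

lemma SBD_R_eq_S:
  assumes n: "1 \<le> n" and x: "x \<in> others_span X n"
  shows "SBD_R X n x = S n x"
  unfolding SBD_R_def
proof (rule proj_along_eqI)
  show "subspace (block X 1 (n - 1))" "subspace (tail_span X (n + 1))"
    by (simp_all add: block_def tail_span_def subspace_closed_span)
  show "S n x \<in> block X 1 (n - 1)"
    unfolding block_def by (rule S_in_closed_span) auto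
  have 1: "{1..n - 1} \<subseteq> {1..<n}" using n by auto
  (* the sum is direct: S n is the identity on the block and vanishes on the tail *)
  have "u = 0" if "u \<in> block X 1 (n - 1)" "u \<in> tail_span X (n + 1)" for u
    using that S_closed_span_below[OF 1, of u] S_closed_span_above[of "{n+1..}" n u] n
    by (auto simp: block_def tail_span_def)
  then show "block X 1 (n - 1) \<inter> tail_span X (n + 1) \<subseteq> {0}" by blast
  let ?Q = "id_blinfun - S n"
  have "others_span X n \<subseteq> ?Q -` tail_span X (n + 1)"
    unfolding others_span_def
  proof (rule closed_span_subset)
    show "subspace (?Q -` tail_span X (n + 1))"
      unfolding tail_span_def
      by (intro linear_subspace_vimage subspace_closed_span bounded_linear.linear blinfun.bounded_linear_right)
    show "closed (?Q -` tail_span X (n + 1))"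
      unfolding tail_span_def
      by (intro continuous_closed_vimage closed_closed_span continuous_intros)
    fix i assume i: "i \<in> {1..} - {n}"
    show "X i \<subseteq> ?Q -` tail_span X (n + 1)"
    proof
      fix y assume y: "y \<in> X i"
      have "y \<in> tail_span X (n + 1)" if "\<not> i < n"
        using that i y summand_subset_closed_span[of i "{n+1..}" X]
        by (auto simp: tail_span_def)
      then show "y \<in> ?Q -` tail_span X (n + 1)"
        using i y subspace_0[OF subspace_closed_span, of X "{n+1..}"]
        by (auto simp: blinfun.diff_left S_X tail_span_def)
    qed
  qed
  then show "x - S n x \<in> tail_span X (n + 1)"
    using x by (auto simp: blinfun.diff_left)
qed

text \<open>
The algebraic span of the summands, described by the property that gliding hump arguments use.
\<close>

definition finitary :: "'a set" where
  "finitary = {x. \<exists>N. \<forall>n\<ge>N. S n x = x}"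

lemma subspace_finitary: "subspace finitary"
  unfolding subspace_def
proof (intro conjI ballI allI)
  show "0 \<in> finitary" by (simp add: finitary_def)
  show "x + y \<in> finitary" if xy: "x \<in> finitary" "y \<in> finitary" for x y
  proof -
    obtain N M where "\<forall>n\<ge>N. S n x = x" "\<forall>n\<ge>M. S n y = y"
      using xy by (auto simp: finitary_def)
    then show ?thesis
      unfolding finitary_def by (auto intro!: exI[of _ "max N M"] simp: blinfun.add_right)
  qed
  show "c *\<^sub>R x \<in> finitary" if "x \<in> finitary" for c x
    using that by (auto simp: finitary_def blinfun.scaleR_right)
qed

lemma X_subset_finitary: "1 \<le> i \<Longrightarrow> X i \<subseteq> finitary"
  unfolding finitary_def by (auto intro!: exI[of _ "Suc i"] simp: S_X)

lemma span_subset_finitary: "span (\<Union>i\<in>{1..} - A. X i) \<subseteq> finitary"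
  using X_subset_finitary by (intro span_minimal subspace_finitary UN_least) auto

lemma SBD_p_eq_0_of_S:
  assumes "1 \<le> n" "S n x = x" "S (Suc n) x = x"
  shows "SBD_p X n x = 0"
  using assms S_Suc[of n x] by simp

lemma bidual_component:
  fixes \<xi> :: "'a bidual"
  assumes n: "1 \<le> n"
  shows "\<exists>a\<in>X n. \<forall>f. \<xi> (f o\<^sub>L SBD_p X n) = f a"
proof -
  obtain B where "finite B" "span B = X n"
    using findim[OF n] by blast
  then show ?thesis
    using finite_rank_bidual[of B "SBD_p X n" \<xi>] SBD_p_in[OF n] by (auto simp: image_subset_iff)
qed

end

section \<open>Gliding humps and skipped gaps\<close>

context skipped_blocking_decomposition begin

text \<open>
Used twice: to refute large norms of the restrictions of \<open>S n\<close>, and to correct a bidual element at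
infinitely many indices.  The relation \<open>Q k x\<close> says what the hump \<open>x\<close> does at the index \<open>k\<close>.  The
hypothesis yields humps that avoid finitely many earlier indices.  Choosing each new index beyond
the support of the previous hump makes the earlier humps avoid the later indices as well, and
choosing each new hump small relative to the earlier \<open>S (k i)\<close> makes it invisible to them.
\<close>

lemma gliding_hump:
  fixes Q :: "nat \<Rightarrow> 'a \<Rightarrow> bool"
  assumes H: "\<And>A N \<delta>. finite A \<Longrightarrow> A \<subseteq> {1..<N} \<Longrightarrow> 0 < \<delta> \<Longrightarrow>
    \<exists>k\<ge>N. \<exists>x\<in>finitary. (\<forall>i\<in>A. SBD_p X i x = 0) \<and> norm x \<le> \<delta> \<and> Q k x"
  obtains k x where "2 \<le> k 0" "\<And>j. k j + 2 \<le> k (Suc j)" "\<And>j. Q (k j) (x j)"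
    "\<And>i j. i \<noteq> j \<Longrightarrow> SBD_p X (k i) (x j) = 0"
    "\<And>j n. k (Suc j) \<le> n \<Longrightarrow> S n (x j) = x j"
    "\<And>j. norm (x j) \<le> (1/2)^j"
    "\<And>i j. i < j \<Longrightarrow> norm (S (k i)) * norm (x j) \<le> (1/2)^j"
proof -
  (* A state (A, k, x) consists of the indices chosen so far, k being the last of them, and the hump
     at k. *)
  define P where "P j s \<longleftrightarrow> (case s of (A, k, x) \<Rightarrow> finite A \<and> A \<subseteq> {1..k} \<and> k \<in> A \<and> 2 \<le> k \<and>
      x \<in> finitary \<and> Q k x \<and> norm x \<le> (1/2)^j \<and>
      (\<forall>i\<in>A - {k}. SBD_p X i x = 0 \<and> norm (S i) * norm x \<le> (1/2)^j))" for j :: nat and s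
  define R :: "nat set \<times> nat \<times> 'a \<Rightarrow> nat set \<times> nat \<times> 'a \<Rightarrow> bool"
    where "R s s' \<longleftrightarrow> (case s of (A, k, x) \<Rightarrow> case s' of (A', k', x') \<Rightarrow>
      A' = insert k' A \<and> k + 2 \<le> k' \<and> (\<forall>n\<ge>k'. S n x = x))" for s s'
  have "\<exists>f. \<forall>j. P j (f j) \<and> R (f j) (f (Suc j))"
  proof (rule dependent_nat_choice)
    obtain k x where "2 \<le> k" "x \<in> finitary" "norm x \<le> 1" "Q k x"
      using H[OF finite.emptyI empty_subsetI zero_less_one, of 2] by blast
    then have "P 0 ({k}, k, x)" by (auto simp: P_def)
    then show "\<exists>s. P 0 s" by blast
  next
    fix s and j :: nat
    assume Ps: "P j s"
    obtain A k x where s: "s = (A, k, x)" by (cases s)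
    have A: "finite A" "A \<subseteq> {1..k}" and x: "x \<in> finitary"
      using Ps by (auto simp: P_def s)
    obtain N where N: "\<And>n. n \<ge> N \<Longrightarrow> S n x = x"
      using x by (auto simp: finitary_def)
    define M where "M = 1 + (\<Sum>i\<in>A. norm (S i))"
    have M: "1 \<le> M" "norm (S i) \<le> M" if "i \<in> A" for i
      using A(1) that member_le_sum[of i A "\<lambda>i. norm (S i)"]
      by (simp_all add: M_def sum_nonneg)
    have M1: "1 \<le> M" by (simp add: M_def sum_nonneg)
    have "{1..k} \<subseteq> {1..<max N (k + 2)}" by auto
    with A(2) have "A \<subseteq> {1..<max N (k + 2)}" by (rule order_trans)
    moreover have "0 < (1/2)^Suc j / M" using M1 by simp
    ultimately obtain k' x' where k': "max N (k + 2) \<le> k'" and x': "x' \<in> finitary"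
      "\<forall>i\<in>A. SBD_p X i x' = 0" "norm x' \<le> (1/2)^Suc j / M" "Q k' x'"
      using H[OF A(1), of "max N (k + 2)" "(1/2)^Suc j / M"] by blast
    have Mx: "M * norm x' \<le> (1/2)^Suc j"
      using x'(3) M1 by (simp add: field_simps)
    have "k' \<notin> A" using A(2) k' by auto
    then have "insert k' A - {k'} = A" by auto
    moreover have "norm x' \<le> (1/2)^Suc j"
      using Mx mult_right_mono[OF M1, of "norm x'"] by simp
    moreover have "norm (S i) * norm x' \<le> (1/2)^Suc j" if "i \<in> A" for i
      using Mx mult_right_mono[OF M(2)[OF that], of "norm x'"] by simp
    ultimately have "P (Suc j) (insert k' A, k', x')"
      using A k' x' unfolding P_def by (auto simp del: power_Suc)
    moreover have "R s (insert k' A, k', x')"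
      using k' N by (auto simp: R_def s)
    ultimately show "\<exists>s'. P (Suc j) s' \<and> R s s'" by blast
  qed
  then obtain f where f: "\<And>j. P j (f j)" "\<And>j. R (f j) (f (Suc j))" by blast
  define A k x where "A j = fst (f j)" and "k j = fst (snd (f j))" and "x j = snd (snd (f j))" for j
  have f_eq: "f j = (A j, k j, x j)" for j by (simp add: A_def k_def x_def)
  have P: "k j \<in> A j" "2 \<le> k j" "Q (k j) (x j)" "norm (x j) \<le> (1/2)^j"
    "\<And>i. i \<in> A j - {k j} \<Longrightarrow> SBD_p X i (x j) = 0 \<and> norm (S i) * norm (x j) \<le> (1/2)^j" for j
    using f(1)[of j] by (auto simp: P_def f_eq)
  have R: "A (Suc j) = insert (k (Suc j)) (A j)" "k j + 2 \<le> k (Suc j)"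
    "\<And>n. k (Suc j) \<le> n \<Longrightarrow> S n (x j) = x j" for j
    using f(2)[of j] by (auto simp: R_def f_eq)
  have "k j < k (Suc j)" for j using R(2)[of j] by linarith
  then have mono: "strict_mono k" by (simp add: strict_mono_Suc_iff)
  have A_mono: "A i \<subseteq> A j" if "i \<le> j" for i j
    using that by (rule lift_Suc_mono_le[rotated]) (auto simp: R(1))
  then have earlier: "k i \<in> A j - {k j}" if "i < j" for i j
    using P(1)[of i] strict_monoD[OF mono that] that subsetD[OF A_mono[of i j]] by simp
  show thesis
  proof (rule that[of k x])
    show "SBD_p X (k i) (x j) = 0" if "i \<noteq> j" for i j
    proof (cases "i < j")
      case True
      then show ?thesis using P(5) earlier by blast
    next
      case False
      then have "k (Suc j) \<le> k i"
        using that strict_mono_less_eq[OF mono] by simp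
      then show ?thesis
        using R(3)[of j "k i"] R(3)[of j "Suc (k i)"] P(2)[of i]
        by (intro SBD_p_eq_0_of_S) auto
    qed
    show "norm (S (k i)) * norm (x j) \<le> (1/2)^j" if "i < j" for i j
      using P(5) earlier[OF that] by blast
  qed (use P R in auto)
qed

text \<open>
A sequence \<open>k\<close> of omitted indices leaves the gaps \<open>{gap_starts k j..k j - 1}\<close>.  When \<open>k\<close> starts at
\<open>2\<close> or later and grows by at least \<open>2\<close>, the gaps are nonempty, hence form a skipped sequence.
\<close>

definition gap_starts :: "(nat \<Rightarrow> nat) \<Rightarrow> nat \<Rightarrow> nat" where
  "gap_starts k j = (case j of 0 \<Rightarrow> 1 | Suc i \<Rightarrow> k i + 1)"

lemma gap_starts_simps [simp]: "gap_starts k 0 = 1" "gap_starts k (Suc i) = k i + 1"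
  by (simp_all add: gap_starts_def)

context
  fixes k :: "nat \<Rightarrow> nat"
  assumes k0: "2 \<le> k 0" and k_Suc: "\<And>j. k j + 2 \<le> k (Suc j)"
begin

lemma gaps_strict_mono: "strict_mono k"
proof -
  have "k j < k (Suc j)" for j using k_Suc[of j] by linarith
  then show ?thesis by (simp add: strict_mono_Suc_iff)
qed

lemma gaps_ge_2: "2 \<le> k j"
proof (induction j)
  case (Suc j)
  then show ?case using k_Suc[of j] by linarith
qed (rule k0)

lemma skipped_gaps: "skipped (gap_starts k) (\<lambda>j. k j - 1)"
  unfolding skipped_def
proof (intro allI)
  fix i
  show "1 \<le> gap_starts k i \<and> gap_starts k i < k i - 1 + 1 \<and> k i - 1 + 1 < gap_starts k (Suc i)"
    using k0 k_Suc[of "i - 1"] gaps_ge_2[of i] by (cases i) auto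
qed

lemma S_block:
  assumes "u \<in> block X (gap_starts k i) (k i - 1)"
  shows "S (k m) u = (if i \<le> m then u else 0)"
proof (cases "i \<le> m")
  case True
  then have "k i \<le> k m"
    using strict_mono_less_eq[OF gaps_strict_mono] by simp
  moreover have "1 \<le> gap_starts k i"
    by (cases i) auto
  ultimately have "{gap_starts k i..k i - 1} \<subseteq> {1..<k m}"
    using gaps_ge_2[of i] by auto
  then show ?thesis
    using S_closed_span_below assms True by (simp add: block_def)
next
  case False
  then obtain i' where i': "i = Suc i'" "m \<le> i'" by (cases i) auto
  then have "k m \<le> k i'"
    using strict_mono_less_eq[OF gaps_strict_mono] by simp
  then have "{gap_starts k i..k i - 1} \<subseteq> {k m..}"
    by (auto simp: i'(1))
  then show ?thesis
    using S_closed_span_above[OF _ _ assms[unfolded block_def], of "k m"] False gaps_ge_2[of m]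
    by simp
qed

lemma in_closed_span_gaps:
  assumes "S n y = y" "\<And>j. SBD_p X (k j) y = 0"
  shows "y \<in> closed_span (\<lambda>j. block X (gap_starts k j) (k j - 1)) UNIV"
proof -
  let ?G = "closed_span (\<lambda>j. block X (gap_starts k j) (k j - 1)) UNIV"
  have "S n y \<in> ?G"
    unfolding S_apply
  proof (intro subspace_sum subspace_closed_span)
    fix i assume i: "i \<in> {1..<n}"
    show "SBD_p X i y \<in> ?G"
    proof (cases "i \<in> range k")
      case True
      then show ?thesis using assms(2) subspace_0[OF subspace_closed_span] by auto
    next
      case False
      (* the gap that contains i ends at the first omitted index above i *)
      define j where "j = (LEAST j. i < k j)"
      have ex: "i < k (Suc i)"
        using strict_mono_imp_increasing[OF gaps_strict_mono, of "Suc i"] by simp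
      have ij: "i < k j"
        unfolding j_def using ex by (rule LeastI)
      have "gap_starts k j \<le> i"
      proof (cases j)
        case 0
        then show ?thesis using i by simp
      next
        case (Suc j')
        then have "\<not> i < k j'"
          unfolding j_def using not_less_Least[of j' "\<lambda>j. i < k j"] by simp
        moreover have "i \<noteq> k j'" using False by auto
        ultimately show ?thesis using Suc by simp
      qed
      then have "i \<in> {gap_starts k j..k j - 1}" using ij by simp
      moreover have "SBD_p X i y \<in> X i" using i by (intro SBD_p_in) simp
      ultimately have "SBD_p X i y \<in> block X (gap_starts k j) (k j - 1)"
        unfolding block_def by (rule subsetD[OF summand_subset_closed_span])
      then show ?thesis
        by (rule subsetD[OF summand_subset_closed_span
            [of j UNIV "\<lambda>j. block X (gap_starts k j) (k j - 1)", OF UNIV_I]])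
    qed
  qed
  then show ?thesis using assms(1) by simp
qed

text \<open>
\<open>S (k m)\<close> is the partial sum projection onto the first \<open>m + 1\<close> gaps.  As it is continuous, it
sends the expansion of \<open>y\<close> to a partial sum of that expansion.
\<close>

lemma S_tendsto:
  assumes y: "y \<in> closed_span (\<lambda>j. block X (gap_starts k j) (k j - 1)) UNIV"
  shows "(\<lambda>m. S (k m) y) \<longlonglongrightarrow> y"
proof -
  have "FDD_of_span (\<lambda>j. block X (gap_starts k j) (k j - 1))"
    using SBD skipped_gaps unfolding SBD_def by blast
  then obtain f where f: "\<And>i. f i \<in> block X (gap_starts k i) (k i - 1)" "f sums y"
    using y unfolding FDD_of_span_def by blast
  have "S (k m) y = (\<Sum>i<Suc m. f i)" for m
  proof -
    have "(\<lambda>i. S (k m) (f i)) sums S (k m) y"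
      using f(2) by (rule bounded_linear.sums[OF blinfun.bounded_linear_right])
    moreover have "(\<lambda>i. S (k m) (f i)) sums (\<Sum>i<Suc m. S (k m) (f i))"
      by (rule sums_finite) (auto simp: S_block[OF f(1)])
    moreover have "(\<Sum>i<Suc m. S (k m) (f i)) = (\<Sum>i<Suc m. f i)"
      by (intro sum.cong) (auto simp: S_block[OF f(1)])
    ultimately show ?thesis by (metis sums_unique2)
  qed
  then show ?thesis
    using LIMSEQ_Suc[OF f(2)[unfolded sums_def]] by presburger
qed

end

end

section \<open>Boundedness of the partial projections\<close>

lemma closed_span_sums:
  assumes "\<And>j. x j \<in> closed_span F I" "x sums y"
  shows "y \<in> closed_span F I"
proof (rule closed_sequentially[OF closed_closed_span])
  show "(\<lambda>n. \<Sum>j<n. x j) \<longlonglongrightarrow> y"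
    using assms(2) by (simp add: sums_def)
  show "(\<Sum>j<n. x j) \<in> closed_span F I" for n
    by (intro subspace_sum[OF subspace_closed_span] assms(1))
qed

lemma half_powers_tail: "(\<lambda>j. (1/2::real) ^ (j + Suc m)) sums (1/2) ^ m"
proof -
  have "(\<lambda>j. (1/2) ^ Suc j * (1/2::real) ^ m) sums (1 * (1/2) ^ m)"
    by (intro sums_mult2 power_half_series)
  then show ?thesis by (simp add: power_add)
qed

lemma summable_half_powers:
  fixes x :: "nat \<Rightarrow> 'a::banach"
  assumes "\<And>j. norm (x j) \<le> (1/2)^j"
  shows "summable x"
proof (rule summable_comparison_test'[of "\<lambda>j. (1/2)^j" 0 x])
  show "summable (\<lambda>j. (1/2::real)^j)"
    by (rule summable_geometric) simp
qed (rule assms)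

context skipped_blocking_decomposition begin

text \<open>
Removing finitely many coordinates perturbs little when the norm of the vector is small compared with
the projections removed; this is how humps are made to avoid earlier indices.
\<close>

definition strip :: "nat set \<Rightarrow> 'a \<Rightarrow> 'a" where
  "strip A y = y - (\<Sum>i\<in>A. SBD_p X i y)"

lemma
  assumes A: "finite A" "A \<subseteq> {1..}"
  shows strip_finitary: "y \<in> finitary \<Longrightarrow> strip A y \<in> finitary"
    and SBD_p_strip: "1 \<le> n \<Longrightarrow> SBD_p X n (strip A y) = (if n \<in> A then 0 else SBD_p X n y)"
    and norm_strip_le: "norm (strip A y) \<le> (1 + (\<Sum>i\<in>A. norm (SBD_p X i))) * norm y"
    and norm_S_strip_ge: "A \<subseteq> {1..<n} \<Longrightarrow>
      norm (S n y) - (\<Sum>i\<in>A. norm (SBD_p X i)) * norm y \<le> norm (S n (strip A y))"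
proof -
  have mem: "SBD_p X i y \<in> finitary" if "i \<in> A" for i
    using that A X_subset_finitary[of i] SBD_p_in[of i y] by auto
  show "y \<in> finitary \<Longrightarrow> strip A y \<in> finitary"
    unfolding strip_def
    by (intro subspace_diff[OF subspace_finitary] subspace_sum[OF subspace_finitary] mem)
  show "SBD_p X n (strip A y) = (if n \<in> A then 0 else SBD_p X n y)" if n: "1 \<le> n"
  proof -
    have "(\<Sum>i\<in>A. SBD_p X n (SBD_p X i y)) = (\<Sum>i\<in>A. if n = i then SBD_p X n y else 0)"
      using A n by (intro sum.cong) (auto simp: SBD_p_comp)
    also have "\<dots> = (if n \<in> A then SBD_p X n y else 0)"
      using A by (simp add: sum.delta)
    finally show ?thesis
      by (simp add: strip_def blinfun.diff_right blinfun.sum_right)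
  qed
  have sum_le: "norm (\<Sum>i\<in>A. SBD_p X i y) \<le> (\<Sum>i\<in>A. norm (SBD_p X i)) * norm y"
    unfolding sum_distrib_right by (intro sum_norm_le norm_blinfun)
  show "norm (strip A y) \<le> (1 + (\<Sum>i\<in>A. norm (SBD_p X i))) * norm y"
    using norm_triangle_ineq4[of y "\<Sum>i\<in>A. SBD_p X i y"] sum_le
    by (simp add: strip_def algebra_simps)
  show "norm (S n y) - (\<Sum>i\<in>A. norm (SBD_p X i)) * norm y \<le> norm (S n (strip A y))"
    if An: "A \<subseteq> {1..<n}"
  proof -
    have "S n (SBD_p X i y) = SBD_p X i y" if "i \<in> A" for i
      using that An SBD_p_in[of i y] by (subst S_X[of i]) auto
    then have "S n (strip A y) = S n y - (\<Sum>i\<in>A. SBD_p X i y)"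
      by (simp add: strip_def blinfun.diff_right blinfun.sum_right)
    then show ?thesis
      using norm_triangle_ineq2[of "S n y" "\<Sum>i\<in>A. SBD_p X i y"] sum_le by simp
  qed
qed

lemma finitary_approximation:
  assumes n: "1 \<le> n" and x: "SBD_p X n x = 0" and U: "open U" "x \<in> U"
  obtains z where "z \<in> finitary" "SBD_p X n z = 0" "z \<in> U"
proof -
  let ?W = "span (\<Union>i\<in>{1..} - {n}. X i)"
  have "x \<in> closure ?W"
    using x n others_span_iff by (simp add: others_span_def closed_span_def)
  then have "U \<inter> ?W \<noteq> {}"
    using U open_Int_closure_eq_empty by blast
  then obtain z where z: "z \<in> ?W" "z \<in> U" by blast
  then have "z \<in> others_span X n"
    using closure_subset by (auto simp: others_span_def closed_span_def)
  then show thesis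
    using that z n others_span_iff span_subset_finitary by blast
qed

text \<open>
This is the finiteness of the asymptotic constant.  Otherwise there are humps \<open>x j\<close>, as small as
desired, whose components at all indices \<open>k i\<close> vanish, with \<open>norm (S (k j) (x j)) \<ge> 1\<close>.  Their sum \<open>y\<close> lies in
the closed span of the gaps, so \<open>S (k m) y\<close> converges to \<open>y\<close>.  But \<open>S (k m) y\<close> differs from the
partial sum of the first \<open>m\<close> humps by \<open>S (k m) (x m)\<close> and an error of at most \<open>(1/2) ^ m\<close>.
\<close>

lemma partial_projections_bounded:
  "\<exists>C N. \<forall>n\<ge>N. \<forall>x. SBD_p X n x = 0 \<longrightarrow> norm (S n x) \<le> C * norm x"
proof (rule ccontr)
  assume "\<not> ?thesis"
  then have unbounded: "\<exists>n\<ge>N. \<exists>x. SBD_p X n x = 0 \<and> C * norm x < norm (S n x)" for C N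
    by (meson not_le)
  have H: "\<exists>k\<ge>N. \<exists>x\<in>finitary. (\<forall>i\<in>A. SBD_p X i x = 0) \<and> norm x \<le> \<delta> \<and>
      (SBD_p X k x = 0 \<and> 1 \<le> norm (S k x))"
    if A: "finite A" "A \<subseteq> {1..<N}" and \<delta>: "0 < \<delta>" for A N \<delta>
  proof -
    have A1: "A \<subseteq> {1..}" using A(2) by auto
    define c where "c = (\<Sum>i\<in>A. norm (SBD_p X i))"
    have c: "0 \<le> c" by (simp add: c_def sum_nonneg)
    (* With norm (S n y) = 2, this makes (1 + c) * norm y at most 1 and at most \<delta>, so stripping y
       keeps norm (S n y) at least 1 and leaves a vector of norm at most \<delta>. *)
    define C where "C = 2 * ((1 + c) * (1 + 1 / \<delta>))"
    have C: "0 < C" using c \<delta> by (simp add: C_def add_pos_nonneg)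
    obtain n x\<^sub>0 where n: "max N 1 \<le> n" and x0: "SBD_p X n x\<^sub>0 = 0" "C * norm x\<^sub>0 < norm (S n x\<^sub>0)"
      using unbounded[of "max N 1" C] by blast
    have "open {z. C * norm z < norm (S n z)}"
      by (intro open_Collect_less continuous_intros)
    then obtain z where z: "z \<in> finitary" "SBD_p X n z = 0" "C * norm z < norm (S n z)"
      using finitary_approximation[of n x\<^sub>0 "{z. C * norm z < norm (S n z)}"] x0 n by auto
    have r: "0 < norm (S n z)"
      using z(3) C by (meson le_less_trans mult_nonneg_nonneg less_imp_le norm_ge_zero)
    define y where "y = (2 / norm (S n z)) *\<^sub>R z"
    have y: "y \<in> finitary" "SBD_p X n y = 0" "norm (S n y) = 2"
      using z r subspace_scale[OF subspace_finitary]
      by (simp_all add: y_def blinfun.scaleR_right)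
    have "C * norm y < 2"
      using z(3) r by (simp add: y_def field_simps)
    moreover have "C * norm y = 2 * ((1 + c) * norm y * (1 + 1 / \<delta>))"
      by (simp add: C_def mult_ac)
    ultimately have w: "(1 + c) * norm y * (1 + 1 / \<delta>) \<le> 1"
      by linarith
    have w0: "0 \<le> (1 + c) * norm y" using c by simp
    have w1: "(1 + c) * norm y \<le> 1"
      using w mult_left_mono[OF _ w0, of 1 "1 + 1 / \<delta>"] \<delta> by simp
    have w\<delta>: "(1 + c) * norm y \<le> \<delta>"
    proof -
      have "(1 + c) * norm y * (1 / \<delta>) \<le> (1 + c) * norm y * (1 + 1 / \<delta>)"
        using w0 by (intro mult_left_mono) auto
      then have "(1 + c) * norm y * (1 / \<delta>) \<le> 1" using w by linarith
      then show ?thesis using \<delta> by (simp add: field_simps)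
    qed
    have An: "A \<subseteq> {1..<n}" "n \<notin> A" using A(2) n by auto
    have "norm (strip A y) \<le> \<delta>"
      using norm_strip_le[OF A(1) A1, of y] w\<delta> by (simp add: c_def)
    moreover have "1 \<le> norm (S n (strip A y))"
      using norm_S_strip_ge[OF A(1) A1 An(1), of y] w1 y(3)
      by (simp add: c_def[symmetric] algebra_simps) (use norm_ge_zero[of y] in linarith)
    moreover have "\<forall>i\<in>A. SBD_p X i (strip A y) = 0" "SBD_p X n (strip A y) = 0"
      using SBD_p_strip[OF A(1) A1] A1 n y(2) by auto
    moreover have "strip A y \<in> finitary"
      using strip_finitary[OF A(1) A1 y(1)] .
    moreover have "N \<le> n" using n by simp
    ultimately show ?thesis by blast
  qed
  obtain k x where k: "2 \<le> k 0" "\<And>j. k j + 2 \<le> k (Suc j)"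
    and Q: "\<And>j. SBD_p X (k j) (x j) = 0 \<and> 1 \<le> norm (S (k j) (x j))"
    and off: "\<And>i j. i \<noteq> j \<Longrightarrow> SBD_p X (k i) (x j) = 0"
    and S_x: "\<And>j n. k (Suc j) \<le> n \<Longrightarrow> S n (x j) = x j"
    and x: "\<And>j. norm (x j) \<le> (1/2)^j"
    and Sk: "\<And>i j. i < j \<Longrightarrow> norm (S (k i)) * norm (x j) \<le> (1/2)^j"
    by (rule gliding_hump[of "\<lambda>k x. SBD_p X k x = 0 \<and> 1 \<le> norm (S k x)"], erule (2) H)
      (rule that; assumption)
  have summable: "summable x"
    using x by (rule summable_half_powers)
  define y where "y = suminf x"
  have sums: "x sums y" using summable by (simp add: y_def summable_sums)
  have "SBD_p X (k i) (x j) = 0" for i j using Q off by (cases "i = j") auto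
  then have "x j \<in> closed_span (\<lambda>j. block X (gap_starts k j) (k j - 1)) UNIV" for j
    by (rule in_closed_span_gaps[OF k S_x[OF order_refl]])
  then have "(\<lambda>m. S (k m) y) \<longlonglongrightarrow> y"
    by (intro S_tendsto[OF k] closed_span_sums[OF _ sums])
  moreover have "(\<lambda>m. \<Sum>j<m. x j) \<longlonglongrightarrow> y"
    using sums by (simp add: sums_def)
  ultimately have "(\<lambda>m. S (k m) y - (\<Sum>j<m. x j)) \<longlonglongrightarrow> y - y"
    by (rule tendsto_diff)
  then have "(\<lambda>m. norm (S (k m) y - (\<Sum>j<m. x j))) \<longlonglongrightarrow> 0"
    by (simp add: tendsto_norm_zero)
  then have "\<forall>\<^sub>F m in sequentially. norm (S (k m) y - (\<Sum>j<m. x j)) < 1/2"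
    by (rule order_tendstoD(2)) simp
  then obtain m where m: "1 \<le> m" "norm (S (k m) y - (\<Sum>j<m. x j)) < 1/2"
    unfolding eventually_sequentially by (metis nle_le)
  define t where "t = (\<Sum>j. x (j + Suc m))"
  have "k (Suc j) \<le> k m" if "j < m" for j
    using that strict_mono_less_eq[OF gaps_strict_mono[OF k]] by simp
  then have "(\<Sum>j<m. S (k m) (x j)) = (\<Sum>j<m. x j)"
    by (intro sum.cong) (auto simp: S_x)
  moreover have "y = t + (\<Sum>j<Suc m. x j)"
    unfolding y_def t_def by (rule suminf_split_initial_segment[OF summable])
  ultimately have "S (k m) y - (\<Sum>j<m. x j) = S (k m) t + S (k m) (x m)"
    by (simp add: blinfun.add_right blinfun.sum_right)
  then have "norm (S (k m) (x m)) \<le> norm (S (k m) y - (\<Sum>j<m. x j)) + norm (S (k m) t)"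
    by (metis add_diff_cancel_left' norm_triangle_ineq4)
  moreover have "norm (S (k m) t) \<le> (1/2)^m"
  proof -
    have "S (k m) t = (\<Sum>j. S (k m) (x (j + Suc m)))"
      unfolding t_def using summable
      by (intro bounded_linear.suminf[OF blinfun.bounded_linear_right] summable_ignore_initial_segment)
    also have "norm \<dots> \<le> (\<Sum>j. (1/2) ^ (j + Suc m))"
    proof (rule norm_suminf_le)
      show "norm (S (k m) (x (j + Suc m))) \<le> (1/2) ^ (j + Suc m)" for j
        using norm_blinfun[of "S (k m)" "x (j + Suc m)"] Sk[of m "j + Suc m"] by linarith
    qed (rule sums_summable[OF half_powers_tail])
    also have "\<dots> = (1/2) ^ m"
      using half_powers_tail by (rule sums_unique[symmetric])
    finally show ?thesis .
  qed
  moreover have "(1/2::real)^m \<le> 1/2"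
    using m(1) power_decreasing[of 1 m "1/2::real"] by simp
  ultimately show False
    using m(2) Q[of m] by linarith
qed

end

section \<open>Representation of bidual elements\<close>

context skipped_blocking_decomposition begin

text \<open>
In classical terms, \<open>w\<close> annihilates the annihilator of the kernel \<open>Y\<close> of \<open>SBD_p X n\<close>, hence belongs
to the bidual of \<open>Y\<close>, and the second adjoint of the restriction of \<open>S n\<close> to \<open>Y\<close> has norm at most \<open>C\<close>.
The proof avoids biduals of subspaces: the sublinear functional
\<open>q x = inf {C \<parallel>x - y\<parallel> + \<parallel>S n y\<parallel> | y \<in> Y}\<close> is at most \<open>C \<parallel>x\<parallel>\<close>, is at most \<open>\<parallel>S n y\<parallel>\<close> on \<open>Y\<close>, and has at
the component sum \<open>s\<close> the value \<open>\<parallel>s\<parallel>\<close>.  A linear functional \<open>g\<close> below \<open>q\<close> that attains \<open>\<parallel>s\<parallel>\<close> at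
\<open>s\<close> satisfies \<open>g = g \<circ> S n\<close> on \<open>Y\<close>, so \<open>w\<close> does not distinguish \<open>g\<close> from \<open>g \<circ> S n\<close>, and
\<open>w g = g s = \<parallel>s\<parallel>\<close>.
\<close>

lemma norm_component_sum_le:
  fixes w :: "'a bidual"
  assumes n: "1 \<le> n" and C: "0 \<le> C" "\<And>x. SBD_p X n x = 0 \<Longrightarrow> norm (S n x) \<le> C * norm x"
    and b: "\<And>i. 1 \<le> i \<Longrightarrow> b i \<in> X i" "\<And>i f. 1 \<le> i \<Longrightarrow> w (f o\<^sub>L SBD_p X i) = f (b i)"
    and bn: "b n = 0"
  shows "norm (\<Sum>i\<in>{1..<n}. b i) \<le> C * norm w"
proof -
  define s where "s = (\<Sum>i\<in>{1..<n}. b i)"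
  define Y where "Y = {x. SBD_p X n x = 0}"
  have Y: "subspace Y"
    by (auto simp: Y_def subspace_def blinfun.add_right blinfun.scaleR_right)
  have S_s: "S n s = s"
    using b(1) by (auto simp: s_def blinfun.sum_right S_X intro!: sum.cong)
  have pS: "SBD_p X n (S n x) = 0" for x
    using n by (auto simp: S_apply blinfun.sum_right SBD_p_comp intro!: sum.neutral)
  have SS: "S n (S n x) = S n x" for x
    unfolding S_apply[of n x] using SBD_p_in
    by (auto simp: blinfun.sum_right S_X[OF _ SBD_p_in] intro!: sum.cong)
  define F where "F x y = C * norm (x - y) + norm (S n y)" for x y
  define q where "q x = (INF y\<in>Y. F x y)" for x
  have bdd: "bdd_below (F x ` Y)" for x
    using C(1) by (intro bdd_belowI2[where m = 0]) (simp add: F_def)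
  have "sublinear q"
    unfolding q_def
  proof (rule sublinear_INF[OF _ bdd])
    show "F (x + y) (c + d) \<le> F x c + F y d" for x y c d
    proof -
      have "C * norm (x + y - (c + d)) \<le> C * (norm (x - c) + norm (y - d))"
        using C(1) by (intro mult_left_mono) (metis add_diff_add norm_triangle_ineq)
      then show ?thesis
        using norm_triangle_ineq[of "S n c" "S n d"]
        by (simp add: F_def blinfun.add_right algebra_simps)
    qed
    show "F (t *\<^sub>R x) (t *\<^sub>R c) \<le> t * F x c" if "0 < t" for t x c
      using that by (simp add: F_def blinfun.scaleR_right algebra_simps flip: scaleR_diff_right)
  qed (use Y in \<open>auto simp: subspace_add subspace_scale dest: subspace_0\<close>)
  moreover have le_F: "q x \<le> F x y" if "y \<in> Y" for x y
    unfolding q_def by (rule cINF_lower[OF bdd that])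
  moreover have "q x \<le> C * norm x" for x
    using le_F[OF subspace_0[OF Y], of x] by (simp add: F_def)
  ultimately obtain g :: "'a dual" where g: "\<And>x. g x \<le> q x" "g s = q s" "norm g \<le> C"
    using Hahn_Banach_dominated[of q C s] C(1) by blast
  have "norm s \<le> q s"
    unfolding q_def
  proof (rule cINF_greatest)
    show "Y \<noteq> {}" using subspace_0[OF Y] by auto
    fix y assume y: "y \<in> Y"
    have "s - y \<in> Y"
      using y pS[of s] by (simp add: Y_def S_s blinfun.diff_right)
    then have "norm (S n (s - y)) \<le> C * norm (s - y)"
      using C(2) by (simp add: Y_def)
    then show "norm s \<le> F s y"
      using norm_triangle_ineq[of "s - S n y" "S n y"]
      by (simp add: F_def blinfun.diff_right S_s)
  qed
  have g_0: "g u = 0" if u: "u \<in> Y" "S n u = 0" for u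
    using g(1)[of u] g(1)[of "- u"] le_F[OF u(1), of u] le_F[OF subspace_neg[OF Y u(1)], of "- u"] u(2)
    by (simp add: F_def blinfun.minus_right)
  have g_Y: "g y = g (S n y)" if "y \<in> Y" for y
  proof -
    have "y - S n y \<in> Y" "S n (y - S n y) = 0"
      using that pS[of y] SS[of y] by (simp_all add: Y_def blinfun.diff_right)
    then have "g (y - S n y) = 0" by (rule g_0)
    then show ?thesis by (simp add: blinfun.diff_right)
  qed
  define h where "h = g - (g o\<^sub>L S n)"
  have h_eq: "h = h o\<^sub>L SBD_p X n"
  proof (rule blinfun_eqI)
    fix x
    have "x - SBD_p X n x \<in> Y"
      using n by (simp add: Y_def blinfun.diff_right SBD_p_comp)
    from g_Y[OF this] show "h x = (h o\<^sub>L SBD_p X n) x"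
      by (simp add: h_def blinfun.diff_left blinfun.diff_right)
  qed
  have "g o\<^sub>L S n = (\<Sum>i\<in>{1..<n}. g o\<^sub>L SBD_p X i)"
    by (rule blinfun_eqI) (simp add: S_apply blinfun.sum_left blinfun.sum_right)
  then have "w (g o\<^sub>L S n) = (\<Sum>i\<in>{1..<n}. g (b i))"
    by (simp add: blinfun.sum_right b(2))
  also have "\<dots> = g s"
    by (simp add: s_def blinfun.sum_right)
  finally have "w (g o\<^sub>L S n) = g s" .
  moreover have "w h = 0"
    by (subst h_eq) (simp add: b(2)[OF n] bn)
  ultimately have "w g = g s"
    by (simp add: h_def blinfun.diff_right)
  then have "norm s \<le> norm (w g)"
    using \<open>norm s \<le> q s\<close> g(2) by simp
  also have "\<dots> \<le> norm w * norm g" by (rule norm_blinfun)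
  also have "\<dots> \<le> norm w * C" by (intro mult_left_mono g(3)) simp
  finally show ?thesis by (simp add: s_def mult.commute)
qed

end

lemma norm_canonical_le: "norm (canonical x) \<le> norm x"
  by (rule norm_blinfun_bound) (simp_all, metis mult.commute norm_blinfun real_norm_def)

text \<open>
A functional that vanishes on the other summands factors through the quotient with the same norm, so
it is one of the test functionals in \<open>norm_q_bidual\<close>.
\<close>

lemma norm_q_bidual_bound:
  fixes \<xi> :: "('a::real_normed_vector) bidual" and g :: "'a dual"
  assumes g: "norm g \<le> 1" "\<And>y. y \<in> others_span X n \<Longrightarrow> g y = 0"
  shows "ereal \<bar>\<xi> g\<bar> \<le> norm_q_bidual X n \<xi>"
proof -
  define Y where "Y = others_span X n"
  define \<phi> where "\<phi> c = g (SOME x. x \<in> c)" for c :: "'a set"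
  have \<phi>: "\<phi> (quotient_proj Y x) = g z" if "z \<in> quotient_proj Y x" for x z
  proof -
    have const: "g u = g x" if "u \<in> quotient_proj Y x" for u
      using that g(2) by (auto simp: quotient_proj_def Y_def blinfun.add_right)
    have "(SOME u. u \<in> quotient_proj Y x) \<in> quotient_proj Y x"
      using that by (rule someI)
    then show ?thesis using const that unfolding \<phi>_def by metis
  qed
  have "x \<in> quotient_proj Y x" for x
    using subspace_0[OF subspace_closed_span]
    by (auto simp: quotient_proj_def Y_def others_span_def image_iff intro!: bexI[of _ 0])
  then have comp: "\<phi> \<circ> quotient_proj Y = blinfun_apply g"
    using \<phi> by (intro ext) simp
  have "ereal (norm (\<phi> c)) \<le> quotient_norm c" if "c \<in> quotient_space Y" for c
    unfolding quotient_norm_def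
  proof (rule INF_greatest)
    fix z assume z: "z \<in> c"
    obtain x where "c = quotient_proj Y x"
      using \<open>c \<in> quotient_space Y\<close> by (auto simp: quotient_space_def)
    then have "norm (\<phi> c) = norm (g z)" using \<phi> z by simp
    also have "\<dots> \<le> norm g * norm z" by (rule norm_blinfun)
    also have "\<dots> \<le> norm z" using g(1) by (simp add: mult_left_le_one_le)
    finally show "ereal (norm (\<phi> c)) \<le> ereal (norm z)" by simp
  qed
  then have dual_norm: "quotient_dual_norm Y \<phi> \<le> 1"
    unfolding quotient_dual_norm_def opnorm_on_def
    by (intro SUP_least) (elim CollectE conjE, rule order_trans)
  then have "quotient_dual_norm Y \<phi> < \<infinity>"
    by (rule le_less_trans) simp
  then have "\<phi> \<in> quotient_dual Y"
    unfolding quotient_dual_def mem_Collect_eq comp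
    by (simp add: bounded_linear.linear blinfun.bounded_linear_right)
  moreover have "quotient_biadjoint Y \<xi> \<phi> = \<xi> g"
    by (simp add: quotient_biadjoint_def quotient_adjoint_def comp blinfun_apply_inverse)
  ultimately show ?thesis
    using dual_norm unfolding norm_q_bidual_def opnorm_on_def Y_def[symmetric]
    by (intro SUP_upper2[of \<phi>]) auto
qed

context skipped_blocking_decomposition begin

text \<open>
The \<open>n\<close>-th component \<open>a\<close> of \<open>\<xi>\<close> is also the component of a small vector.  A functional \<open>g\<close> of norm
at most one that vanishes on the other summands and measures the distance from \<open>a\<close> to them satisfies
\<open>\<xi> g = g a\<close>.  So that distance is at most the norm of the image of \<open>\<xi>\<close> in the quotient, and one can
subtract from \<open>a\<close> a nearly closest combination of the other summands.
\<close>

lemma small_lift: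
  fixes \<xi> :: "'a bidual"
  assumes n: "1 \<le> n" and a: "a \<in> X n" "\<And>f. \<xi> (f o\<^sub>L SBD_p X n) = f a"
    and small: "norm_q_bidual X n \<xi> < ereal \<epsilon>"
  obtains z where "z \<in> finitary" "norm z < \<epsilon>" "SBD_p X n z = a"
proof -
  let ?W = "span (\<Union>i\<in>{1..} - {n}. X i)"
  have closure_W: "closure ?W = others_span X n"
    by (simp add: others_span_def closed_span_def)
  obtain g :: "'a dual" where g: "g a = infdist a (others_span X n)" "norm g \<le> 1"
    "\<And>y. y \<in> others_span X n \<Longrightarrow> g y = 0"
    using infdist_functional[of "others_span X n" a] subspace_closed_span
    unfolding others_span_def by metis
  have "g o\<^sub>L SBD_p X n = g"
  proof (rule blinfun_eqI)
    show "(g o\<^sub>L SBD_p X n) x = g x" for x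
      using g(3)[OF diff_SBD_p_in[OF n, of x]] by (simp add: blinfun.diff_right)
  qed
  then have "\<xi> g = g a" using a(2)[of g] by simp
  moreover have "ereal \<bar>\<xi> g\<bar> < ereal \<epsilon>"
    using norm_q_bidual_bound[OF g(2,3), where \<xi> = \<xi>] small by (rule le_less_trans)
  ultimately have "infdist a (others_span X n) < \<epsilon>"
    using g(1) by (simp add: infdist_nonneg)
  then have "infdist a ?W < \<epsilon>"
    by (simp only: infdist_eq_setdist setdist_closure_2 flip: closure_W)
  then have "(INF y\<in>?W. dist a y) < \<epsilon>"
    using span_zero by (subst (asm) infdist_notempty) auto
  then obtain y' where y': "y' \<in> ?W" "dist a y' < \<epsilon>"
    using span_zero by (subst (asm) cINF_less_iff) (auto intro!: bdd_belowI2[where m = 0])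
  show thesis
  proof (rule that[of "a - y'"])
    show "a - y' \<in> finitary"
      using a(1) y'(1) X_subset_finitary[OF n] span_subset_finitary
      by (intro subspace_diff[OF subspace_finitary]) auto
    show "norm (a - y') < \<epsilon>"
      using y'(2) by (simp add: dist_norm)
    have "y' \<in> others_span X n"
      using y'(1) closure_W closure_subset by blast
    then show "SBD_p X n (a - y') = a"
      using n a(1) by (simp add: blinfun.diff_right SBD_p_same others_span_iff)
  qed
qed

lemma asymptotic_constant_finite: "\<exists>K\<ge>0. asymptotic_constant X = ereal K"
proof -
  let ?N = "\<lambda>n. opnorm_on (others_span X n) (\<lambda>x. ereal (norm x)) (SBD_R X n)"
  obtain C N where CN: "\<And>n x. N \<le> n \<Longrightarrow> SBD_p X n x = 0 \<Longrightarrow> norm (S n x) \<le> C * norm x"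
    using partial_projections_bounded by blast
  have "?N n \<le> ereal \<bar>C\<bar>" if n: "max N 1 \<le> n" for n
    unfolding opnorm_on_def
  proof (rule SUP_least)
    fix x assume x: "x \<in> {x \<in> others_span X n. ereal (norm x) \<le> 1}"
    have "norm (S n x) \<le> C * norm x"
      using CN[of n x] x n others_span_iff[of n x] by auto
    also have "\<dots> \<le> \<bar>C\<bar> * 1"
      using x by (intro mult_mono) auto
    finally show "ereal (norm (SBD_R X n x)) \<le> ereal \<bar>C\<bar>"
      using x n SBD_R_eq_S by simp
  qed
  then have "asymptotic_constant X \<le> ereal \<bar>C\<bar>"
    unfolding asymptotic_constant_def
    by (intro Limsup_bounded eventually_mono[OF eventually_ge_at_top])
  moreover have "0 \<le> ?N n" for n
    unfolding opnorm_on_def others_span_def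
    by (rule SUP_upper2[of 0]) (auto simp: subspace_0[OF subspace_closed_span])
  then have "0 \<le> asymptotic_constant X"
    unfolding asymptotic_constant_def
    by (intro le_Limsup) (auto simp: eventually_sequentially)
  ultimately show ?thesis
    by (cases "asymptotic_constant X") auto
qed

text \<open>
The asymptotic constant enters the norm estimate only through this consequence.
\<close>

lemma eventually_norm_S_le:
  assumes "asymptotic_constant X < ereal C"
  shows "\<forall>\<^sub>F n in sequentially. \<forall>x. SBD_p X n x = 0 \<longrightarrow> norm (S n x) \<le> C * norm x"
proof -
  have "\<forall>\<^sub>F n in sequentially.
      opnorm_on (others_span X n) (\<lambda>x. ereal (norm x)) (SBD_R X n) < ereal C"
    using assms unfolding asymptotic_constant_def by (rule Limsup_lessD)
  then show ?thesis
    using eventually_ge_at_top[of 1]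
  proof eventually_elim
    case (elim n)
    show ?case
    proof (intro allI impI)
      fix x assume x: "SBD_p X n x = 0"
      show "norm (S n x) \<le> C * norm x"
      proof (cases "x = 0")
        case False
        define u where "u = (1 / norm x) *\<^sub>R x"
        have u: "u \<in> others_span X n" "norm u \<le> 1"
          using x False elim(2) by (simp_all add: u_def others_span_iff blinfun.scaleR_right)
        then have "u \<in> {x \<in> others_span X n. ereal (norm x) \<le> 1}" by simp
        then have "ereal (norm (SBD_R X n u)) < ereal C"
          using elim(1) unfolding opnorm_on_def by (rule le_less_trans[OF SUP_upper])
        then have "norm (S n u) \<le> C"
          using SBD_R_eq_S[OF elim(2) u(1)] by simp
        then show ?thesis
          using False by (simp add: u_def blinfun.scaleR_right field_simps)
      qed simp
    qed
  qed
qed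

text \<open>
The hypothesis of \<open>gliding_hump\<close> for correcting \<open>\<xi>\<close>: a small vector whose component at a late index
is that of \<open>\<xi>\<close>.
\<close>

lemma vanishing_quotients_hump:
  fixes \<xi> :: "'a bidual"
  assumes a: "\<And>n. 1 \<le> n \<Longrightarrow> a n \<in> X n" "\<And>n f. 1 \<le> n \<Longrightarrow> \<xi> (f o\<^sub>L SBD_p X n) = f (a n)"
    and liminf: "liminf (\<lambda>n. norm_q_bidual X n \<xi>) = 0"
    and A: "finite A" "A \<subseteq> {1..<N}" and \<delta>: "0 < \<delta>"
  shows "\<exists>k\<ge>N. \<exists>x\<in>finitary. (\<forall>i\<in>A. SBD_p X i x = 0) \<and> norm x \<le> \<delta> \<and> SBD_p X k x = a k"
proof -
  have A1: "A \<subseteq> {1..}" using A(2) by auto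
  define c where "c = 1 + (\<Sum>i\<in>A. norm (SBD_p X i))"
  have c: "1 \<le> c" by (simp add: c_def sum_nonneg)
  have "\<exists>n\<ge>max N 1. norm_q_bidual X n \<xi> < ereal (\<delta> / c)"
  proof (rule ccontr)
    assume "\<not> ?thesis"
    then have "\<forall>n\<ge>max N 1. ereal (\<delta> / c) \<le> norm_q_bidual X n \<xi>"
      by (meson not_le)
    then have "ereal (\<delta> / c) \<le> liminf (\<lambda>n. norm_q_bidual X n \<xi>)"
      by (intro Liminf_bounded eventually_mono[OF eventually_ge_at_top]) blast
    moreover have "0 < \<delta> / c" using \<delta> c by simp
    ultimately show False using liminf by (simp add: zero_ereal_def)
  qed
  then obtain n where n: "max N 1 \<le> n" "norm_q_bidual X n \<xi> < ereal (\<delta> / c)" by blast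
  then have n1: "1 \<le> n" by simp
  obtain z where z: "z \<in> finitary" "norm z < \<delta> / c" "SBD_p X n z = a n"
    using small_lift[OF n1 a(1)[OF n1] a(2)[OF n1] n(2)] by blast
  have "n \<notin> A" using A(2) n(1) by auto
  have "c * norm z \<le> \<delta>"
    using z(2) c by (simp add: field_simps)
  then have "norm (strip A z) \<le> \<delta>"
    using norm_strip_le[OF A(1) A1, of z] by (simp add: c_def)
  moreover have "\<forall>i\<in>A. SBD_p X i (strip A z) = 0" "SBD_p X n (strip A z) = a n"
    using SBD_p_strip[OF A(1) A1] A1 n1 z(3) \<open>n \<notin> A\<close> by auto
  ultimately show ?thesis
    using n(1) strip_finitary[OF A(1) A1 z(1)] by (intro exI[of _ n]) auto
qed

text \<open>
Subtracting the sum \<open>z\<close> of the humps from \<open>\<xi>\<close> kills the components at all indices \<open>k m\<close>.  The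
initial component sums \<open>s m\<close> of the difference then live on the skipped gaps, where bounded
completeness turns their boundedness into convergence, to \<open>x'\<close> say; the representing vector is
\<open>x' + z\<close>.  Estimating \<open>s m\<close> alone would cost the norm of \<open>z\<close>.  Instead \<open>s m + Z m\<close>, with \<open>Z m\<close> the sum
of the first \<open>m\<close> humps, is the component sum of \<open>\<xi> - (z - Z m)\<close>, and \<open>z - Z m\<close> tends to \<open>0\<close>, so the
limit \<open>x' + z\<close> has norm at most \<open>K \<parallel>\<xi>\<parallel>\<close>.
\<close>

lemma bidual_represented:
  fixes \<xi> :: "'a bidual"
  assumes bc: "boundedly_complete_SBD X"
    and K: "asymptotic_constant X = ereal K" "0 \<le> K"
    and a: "\<And>n. 1 \<le> n \<Longrightarrow> a n \<in> X n" "\<And>n f. 1 \<le> n \<Longrightarrow> \<xi> (f o\<^sub>L SBD_p X n) = f (a n)"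
    and liminf: "liminf (\<lambda>n. norm_q_bidual X n \<xi>) = 0"
  shows "\<exists>x. norm x \<le> K * norm \<xi> \<and> (\<forall>n\<ge>1. SBD_p X n x = a n)"
proof -
  have H: "\<exists>k\<ge>N. \<exists>x\<in>finitary. (\<forall>i\<in>A. SBD_p X i x = 0) \<and> norm x \<le> \<delta> \<and> SBD_p X k x = a k"
    if "finite A" "A \<subseteq> {1..<N}" "0 < \<delta>" for A N \<delta>
    using a liminf that by (rule vanishing_quotients_hump)
  obtain k \<zeta> where k: "2 \<le> k 0" "\<And>j. k j + 2 \<le> k (Suc j)"
    and hit: "\<And>j. SBD_p X (k j) (\<zeta> j) = a (k j)"
    and off: "\<And>i j. i \<noteq> j \<Longrightarrow> SBD_p X (k i) (\<zeta> j) = 0"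
    and S_\<zeta>: "\<And>j n. k (Suc j) \<le> n \<Longrightarrow> S n (\<zeta> j) = \<zeta> j"
    and \<zeta>: "\<And>j. norm (\<zeta> j) \<le> (1/2)^j"
    by (rule gliding_hump[of "\<lambda>k x. SBD_p X k x = a k"],
        erule (2) H) (rule that; assumption)
  note mono = gaps_strict_mono[OF k]
  have k1: "1 \<le> k j" for j using gaps_ge_2[OF k, of j] by simp
  have k_shift: "strict_mono (\<lambda>j. k j - 1)"
    unfolding strict_mono_Suc_iff
  proof
    show "k j - 1 < k (Suc j) - 1" for j using k(2)[of j] k1[of j] by simp
  qed
  define Z where "Z m = (\<Sum>j<m. \<zeta> j)" for m
  have "summable \<zeta>"
    using \<zeta> by (rule summable_half_powers)
  then obtain z where z: "\<zeta> sums z" using summable_sums by blast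
  have Z_lim: "Z \<longlonglongrightarrow> z" using z by (simp add: Z_def[abs_def] sums_def)
  have p_z: "SBD_p X (k m) z = a (k m)" for m
  proof -
    have "(\<lambda>j. SBD_p X (k m) (\<zeta> j)) sums SBD_p X (k m) z"
      by (rule bounded_linear.sums[OF blinfun.bounded_linear_right z])
    moreover have "(\<lambda>j. SBD_p X (k m) (\<zeta> j)) sums (\<Sum>j\<in>{m}. SBD_p X (k m) (\<zeta> j))"
      by (rule sums_finite) (auto simp: off)
    ultimately have "SBD_p X (k m) z = (\<Sum>j\<in>{m}. SBD_p X (k m) (\<zeta> j))"
      by (rule sums_unique2)
    then show ?thesis by (simp add: hit)
  qed
  have p_Z: "SBD_p X (k m) (Z m) = 0" for m
    by (auto simp: Z_def blinfun.sum_right off)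
  have S_Z: "S (k m) (Z m) = Z m" for m
  proof -
    have "k (Suc j) \<le> k m" if "j < m" for j
      using that strict_mono_less_eq[OF mono] by simp
    then show ?thesis by (auto simp: Z_def blinfun.sum_right S_\<zeta> intro!: sum.cong)
  qed
  define b where "b n = a n - SBD_p X n z" for n
  define s where "s m = (\<Sum>i\<in>{1..<k m}. b i)" for m
  have b_X: "b n \<in> X n" if "1 \<le> n" for n
    unfolding b_def using a(1)[OF that] SBD_p_in[OF that] subspace_X[OF that]
    by (intro subspace_diff)
  have bound: "\<forall>\<^sub>F m in sequentially. norm (s m + Z m) \<le> C * (norm \<xi> + norm (z - Z m))"
    if "K < C" for C
  proof -
    have C0: "0 \<le> C" using that K(2) by simp
    have "\<forall>\<^sub>F n in sequentially. \<forall>x. SBD_p X n x = 0 \<longrightarrow> norm (S n x) \<le> C * norm x"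
      using that by (intro eventually_norm_S_le) (simp add: K(1))
    then have "\<forall>\<^sub>F m in sequentially. \<forall>x. SBD_p X (k m) x = 0 \<longrightarrow> norm (S (k m) x) \<le> C * norm x"
      by (rule eventually_subseq[OF mono])
    then show ?thesis
    proof eventually_elim
      case (elim m)
      let ?w = "\<xi> - canonical (z - Z m)"
      have "norm (\<Sum>i\<in>{1..<k m}. a i - SBD_p X i (z - Z m)) \<le> C * norm ?w"
      proof (rule norm_component_sum_le[OF k1 C0])
        show "a i - SBD_p X i (z - Z m) \<in> X i" if "1 \<le> i" for i
          using a(1)[OF that] SBD_p_in[OF that] subspace_X[OF that] by (intro subspace_diff)
        show "?w (f o\<^sub>L SBD_p X i) = f (a i - SBD_p X i (z - Z m))" if "1 \<le> i" for i f
          using a(2)[OF that] by (simp add: blinfun.diff_left blinfun.diff_right)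
        show "a (k m) - SBD_p X (k m) (z - Z m) = 0"
          by (simp add: blinfun.diff_right p_z p_Z)
      qed (use elim in blast)
      moreover have "(\<Sum>i\<in>{1..<k m}. a i - SBD_p X i (z - Z m)) = s m + S (k m) (Z m)"
        by (simp add: s_def b_def S_apply blinfun.diff_right sum.distrib sum_subtractf)
      moreover have "norm ?w \<le> norm \<xi> + norm (z - Z m)"
        using norm_triangle_ineq4[of \<xi> "canonical (z - Z m)"] norm_canonical_le[of "z - Z m"]
        by linarith
      then have "C * norm ?w \<le> C * (norm \<xi> + norm (z - Z m))"
        using C0 by (rule mult_left_mono)
      ultimately show ?case by (simp add: S_Z)
    qed
  qed
  have "Bseq s"
  proof (rule Bseq_eventually_mono)
    let ?g = "\<lambda>m. (K + 1) * (norm \<xi> + norm (z - Z m)) + norm (Z m)"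
    show "\<forall>\<^sub>F m in sequentially. norm (s m) \<le> norm (?g m)"
      using bound[of "K + 1", simplified]
    proof eventually_elim
      case (elim m)
      then show ?case using norm_triangle_ineq4[of "s m + Z m" "Z m"] by simp
    qed
    have "?g \<longlonglongrightarrow> (K + 1) * (norm \<xi> + norm (z - z)) + norm z"
      by (intro tendsto_intros Z_lim)
    then show "Bseq ?g" by (rule convergent_imp_Bseq[OF convergentI])
  qed
  define f where "f j = (\<Sum>i\<in>{gap_starts k j..k j - 1}. b i)" for j
  have f_block: "f j \<in> block X (gap_starts k j) (k j - 1)" for j
    unfolding f_def block_def
  proof (intro subspace_sum subspace_closed_span)
    fix i assume i: "i \<in> {gap_starts k j..k j - 1}"
    then have "1 \<le> i" by (cases j) auto
    then show "b i \<in> closed_span X {gap_starts k j..k j - 1}"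
      by (intro subsetD[OF summand_subset_closed_span[OF i]] b_X)
  qed
  have f_sum: "(\<Sum>j<Suc m. f j) = s m" for m
  proof (induction m)
    case 0
    have "{1..k 0 - 1} = {1..<k 0}" using k1[of 0] by auto
    then show ?case by (simp add: f_def s_def)
  next
    case (Suc m)
    have "{k m + 1..k (Suc m) - 1} = {Suc (k m)..<k (Suc m)}"
      using k(2)[of m] by auto
    then have "f (Suc m) = sum b {Suc (k m)..<k (Suc m)}"
      by (simp add: f_def)
    moreover have "sum b {k m..<k (Suc m)} = b (k m) + sum b {Suc (k m)..<k (Suc m)}"
      using k(2)[of m] by (intro sum.atLeast_Suc_lessThan) simp
    moreover have "s (Suc m) = s m + sum b {k m..<k (Suc m)}"
      unfolding s_def using k(2)[of m] k1[of m]
      by (intro sum.atLeastLessThan_concat[symmetric]) simp_all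
    ultimately have "s (Suc m) = s m + b (k m) + f (Suc m)"
      by (simp add: add.assoc)
    then show ?case using Suc.IH by (simp add: b_def p_z)
  qed
  have "Bseq (\<lambda>m. \<Sum>j<Suc m. f j)" using \<open>Bseq s\<close> f_sum by simp
  then have "Bseq (\<lambda>m. \<Sum>j<m. f j)"
    using Bseq_Suc_iff[of "\<lambda>m. \<Sum>j<m. f j"] by blast
  then have "bounded (range (\<lambda>m. \<Sum>j<m. f j))"
    by (simp only: Bseq_eq_bounded)
  moreover have "boundedly_complete (\<lambda>j. block X (gap_starts k j) (k j - 1))"
    using bc skipped_gaps[OF k] unfolding boundedly_complete_SBD_def by blast
  ultimately have "summable f"
    using f_block unfolding boundedly_complete_def by blast
  then obtain x' where "f sums x'" using summable_sums by blast
  then have s_lim: "s \<longlonglongrightarrow> x'"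
    using LIMSEQ_Suc[of "\<lambda>m. \<Sum>j<m. f j" x'] f_sum by (simp add: sums_def)
  have p_x': "SBD_p X n x' = b n" if n: "1 \<le> n" for n
  proof -
    have "(\<lambda>m. SBD_p X n (s m)) \<longlonglongrightarrow> SBD_p X n x'"
      by (intro tendsto_intros s_lim)
    moreover have "SBD_p X n (s m) = b n" if m: "n \<le> m" for m
    proof -
      have "n < k m"
        using strict_mono_imp_increasing[OF k_shift, of m] m k1[of m] by simp
      have "SBD_p X n (s m) = (\<Sum>i\<in>{1..<k m}. if n = i then b n else 0)"
        unfolding s_def blinfun.sum_right using n b_X
        by (intro sum.cong) (auto simp: SBD_p_same SBD_p_other)
      then show ?thesis using n \<open>n < k m\<close> by simp
    qed
    then have "(\<lambda>m. SBD_p X n (s m)) \<longlonglongrightarrow> b n"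
      by (intro tendsto_eventually) (auto simp: eventually_sequentially)
    ultimately show ?thesis by (rule LIMSEQ_unique)
  qed
  have "norm (x' + z) \<le> C * norm \<xi>" if "K < C" for C
  proof (rule tendsto_le[OF _ _ _ bound[OF that]])
    show "(\<lambda>m. norm (s m + Z m)) \<longlonglongrightarrow> norm (x' + z)"
      by (intro tendsto_intros s_lim Z_lim)
    have "(\<lambda>m. C * (norm \<xi> + norm (z - Z m))) \<longlonglongrightarrow> C * (norm \<xi> + norm (z - z))"
      by (intro tendsto_intros Z_lim)
    then show "(\<lambda>m. C * (norm \<xi> + norm (z - Z m))) \<longlonglongrightarrow> C * norm \<xi>" by simp
  qed simp
  then have "\<forall>\<^sub>F C in at_right K. norm (x' + z) \<le> C * norm \<xi>"
    by (simp add: eventually_at_right_less eventually_mono[OF eventually_at_right_less])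
  moreover have "((\<lambda>C. C * norm \<xi>) \<longlongrightarrow> K * norm \<xi>) (at_right K)"
    by (intro tendsto_intros)
  ultimately have "norm (x' + z) \<le> K * norm \<xi>"
    by (intro tendsto_lowerbound) auto
  moreover have "SBD_p X n (x' + z) = a n" if "1 \<le> n" for n
    using p_x'[OF that] by (simp add: b_def blinfun.add_right)
  ultimately show ?thesis by blast
qed

end

theorem proposition6p2:
  fixes X :: "nat \<Rightarrow> 'a::banach set"
  assumes "boundedly_complete_SBD X"
  shows "\<exists>K. asymptotic_constant X = ereal K \<and> norming_JT_decomposition K X"
proof -
  interpret skipped_blocking_decomposition X
    using assms by unfold_locales (simp add: boundedly_complete_SBD_def)
  obtain K where K: "asymptotic_constant X = ereal K" "0 \<le> K"
    using asymptotic_constant_finite by blast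
  have "\<exists>x. norm x \<le> K * norm \<xi> \<and>
      (\<forall>n\<ge>1. blinfun_apply (banach_adjoint (banach_adjoint (SBD_p X n))) \<xi>
        = canonical (blinfun_apply (SBD_p X n) x))"
    if liminf: "liminf (\<lambda>n. norm_q_bidual X n \<xi>) = 0" for \<xi> :: "'a bidual"
  proof -
    have "\<forall>n. \<exists>a. 1 \<le> n \<longrightarrow> a \<in> X n \<and> (\<forall>f. \<xi> (f o\<^sub>L SBD_p X n) = f a)"
      using bidual_component by blast
    then obtain a where a: "\<And>n. 1 \<le> n \<Longrightarrow> a n \<in> X n"
      "\<And>n f. 1 \<le> n \<Longrightarrow> \<xi> (f o\<^sub>L SBD_p X n) = f (a n)"
      by metis
    obtain x where x: "norm x \<le> K * norm \<xi>" "\<And>n. 1 \<le> n \<Longrightarrow> SBD_p X n x = a n"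
      using bidual_represented[OF assms K a liminf] by blast
    have "banach_adjoint (banach_adjoint (SBD_p X n)) \<xi> = canonical (SBD_p X n x)"
      if "1 \<le> n" for n
      by (rule blinfun_eqI) (simp add: a(2)[OF that] x(2)[OF that])
    then show ?thesis using x(1) by blast
  qed
  then show ?thesis
    using K(1) assms unfolding norming_JT_decomposition_def by blast
qed

end
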